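(* Let $\{z_k\}=\{(x_k,y_k)\}$ be a sequence generated by the FDFW applied to the maximization of $h_{\mathcal{G}}$ over $\mathcal{P}_s$, and assume that at least one limit point $p=(x^{(C)},y^{(p)})$ of $\{z_k\}$ is in $\mathcal{M}_s(\mathcal{G})$. Assume that for some constants $c>0$, $\rho>0$ the stepsizes satisfy, for all $k$, $$\alpha_k\ge\bar\alpha_k:=\min\Big(\alpha_k^{\max},\,c\,\frac{\nabla h_{\mathcal{G}}(z_k)^{\intercal}d_k}{\|d_k\|^2}\Big),\qquad h_{\mathcal{G}}(z_k+\alpha_kd_k)-h_{\mathcal{G}}(z_k)\ge\rho\,\bar\alpha_k\,\nabla h_{\mathcal{G}}(z_k)^{\intercal}d_k .$$ Then $z_k\to p$, and $\mathrm{supp}(x_k)\subset C$ and $y_k=y^{(p)}$ for $k$ large enough.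
   Context: $\mathcal{G}=(V,E)$ is a finite simple undirected graph, $n=|V|$, $V$ identified with $\{1,\dots,n\}$, $A_{\mathcal{G}}$ its adjacency matrix, $\bar{\mathcal{G}}=(V,\bar E)$ the complementary graph; $e$ is the all-ones vector; $s\in\mathbb{N}$, $s\le|\bar E|$. $D_s(\mathcal{G})=\{y\in\{0,1\}^{\bar E}:e^{\intercal}y\le s\}$, $D'_s(\mathcal{G})=\{y\in[0,1]^{\bar E}:e^{\intercal}y\le s\}$. For $y\in D'_s(\mathcal{G})$, $A(y)\in\mathbb{R}^{n\times n}$ is the symmetric matrix with $A(y)_{ij}=y_{ij}$ if $\{i,j\}\in\bar E$ and $0$ otherwise; for $y\in D_s(\mathcal{G})$, $\mathcal{G}(y)$ is the graph with adjacency matrix $A_{\mathcal{G}}+A(y)$. $\mathcal{P}_s=\Delta_{n-1}\times D'_s(\mathcal{G})$ with $\Delta_{n-1}$ the standard simplex in $\mathbb{R}^n$. For fixed $\alpha\in(0,2)$, $\beta>0$, $$h_{\mathcal{G}}(x,y)=x^{\intercal}[A_{\mathcal{G}}+A(y)]x+\tfrac{\alpha}{2}\|x\|^2+\tfrac{\beta}{2}\|y\|^2 .$$ $\mathcal{M}_s(\mathcal{G})$ is the set of strict local maximizers of $h_{\mathcal{G}}$ on $\mathcal{P}_s$. For nonempty $C\subseteq V$, $x^{(C)}=\frac{1}{|C|}\sum_{i\in C}e_i$. Every $p\in\mathcal{M}_s(\mathcal{G})$ is of the form $p=(x^{(C)},y^{(p)})$ with $y^{(p)}\in D_s(\mathcal{G})$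 and $C$ a maximal clique of $\mathcal{G}(y^{(p)})$ (which is an $s$-defective clique of $\mathcal{G}$); this is the notation used. FDFW (Frank-Wolfe method with in face directions) for maximizing a smooth (continuously differentiable) $f$ over a polytope $\mathcal{Q}$ (here $f=h_{\mathcal{G}}$, $\mathcal{Q}=\mathcal{P}_s$, iterates denoted $z_k$): for $w\in\mathcal{Q}$ let $\mathcal{F}(w)$ be the minimal face of $\mathcal{Q}$ containing $w$; $w$ is stationary if $\nabla f(w)^{\intercal}(v-w)\le0$ for all $v\in\mathcal{Q}$. Start with $w_0\in\mathcal{Q}$. At iteration $k$: stop if $w_k$ is stationary; otherwise choose $s_k\in\arg\max_{y\in\mathcal{Q}}\nabla f(w_k)^{\intercal}y$, $d_k^{\mathcal{FW}}=s_k-w_k$, and $v_k\in\arg\min_{y\in\mathcal{F}(w_k)}\nabla f(w_k)^{\intercal}y$, $d_k^{\mathcal{FD}}=w_k-v_k$. Set $d_k=d_k^{\mathcal{FW}}$ if $\nabla f(w_k)^{\intercal}d_k^{\mathcal{FW}}\ge\nabla f(w_k)^{\intercal}d_k^{\mathcal{FD}}$, and $d_k=d_k^{\mathcal{FD}}$ otherwise. Choose a stepsize $\alpha_k\in(0,\alpha_k^{\max}]$, where $\alpha_k^{\max}$ is the maximal feasible stepsize $\max\{t\ge0:w_k+td_k\in\mathcal{Q}\}$, and set $w_{k+1}=w_k+\alpha_kd_k$. If the method stops at iteration $k$, the sequence is continued as constant, $w_j=w_k$ for $j\ge k$ (stepsize conditions are then required only before stopping). *)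

theory Defs
  imports "HOL-Analysis.Analysis"
begin

section \<open>First-order optimization over a convex set\<close>

definition grad :: "('a::real_inner \<Rightarrow> real) \<Rightarrow> 'a \<Rightarrow> 'a" where
  "grad f w = (THE D. GDERIV f w :> D)"

lemma grad_eq:
  assumes "GDERIV f w :> D"
  shows "grad f w = D"
  unfolding grad_def
proof (rule the_equality)
  show "GDERIV f w :> D" by (rule assms)
next
  fix D' assume "GDERIV f w :> D'"
  with assms have "(\<lambda>h. h \<bullet> D') = (\<lambda>h. h \<bullet> D)"
    unfolding gderiv_def by (rule has_derivative_unique[rotated])
  then have "\<forall>h. h \<bullet> D' = h \<bullet> D" by (rule fun_cong[THEN allI])
  then show "D' = D" by (simp only: vector_eq_ldot)
qed

definition stationary :: "('a::real_inner \<Rightarrow> real) \<Rightarrow> 'a set \<Rightarrow> 'a \<Rightarrow> bool" where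
  "stationary f Q w \<longleftrightarrow> (\<forall>v\<in>Q. grad f w \<bullet> (v - w) \<le> 0)"

definition strict_local_maximizers :: "('a::real_normed_vector \<Rightarrow> real) \<Rightarrow> 'a set \<Rightarrow> 'a set" where
  "strict_local_maximizers f Q = {p \<in> Q. \<forall>\<^sub>F w in at p within Q. f w < f p}"

definition minimal_face :: "'a::real_vector set \<Rightarrow> 'a \<Rightarrow> 'a set" where
  "minimal_face Q w = \<Inter> {F. F face_of Q \<and> w \<in> F}"

definition max_step :: "'a::real_vector set \<Rightarrow> 'a \<Rightarrow> 'a \<Rightarrow> real" where
  "max_step Q w d = (GREATEST t. 0 \<le> t \<and> w + t *\<^sub>R d \<in> Q)"

definition step_bound ::
    "real \<Rightarrow> ('a::real_inner \<Rightarrow> real) \<Rightarrow> 'a set \<Rightarrow> 'a \<Rightarrow> 'a \<Rightarrow> real" where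
  "step_bound c f Q w d = min (max_step Q w d) (c * ((grad f w \<bullet> d) / (norm d)\<^sup>2))"

definition fdfw_direction ::
    "('a::real_inner \<Rightarrow> real) \<Rightarrow> 'a set \<Rightarrow> 'a \<Rightarrow> 'a \<Rightarrow> bool" where
  "fdfw_direction f Q w d \<longleftrightarrow>
     (\<exists>u v. is_arg_max (\<lambda>y. grad f w \<bullet> y) (\<lambda>y. y \<in> Q) u \<and>
            is_arg_min (\<lambda>y. grad f w \<bullet> y) (\<lambda>y. y \<in> minimal_face Q w) v \<and>
            d = (if grad f w \<bullet> (u - w) \<ge> grad f w \<bullet> (w - v) then u - w else w - v))"

text \<open>
  Iterates \<open>w\<close>, directions \<open>d\<close> and stepsizes \<open>a\<close> of the Frank-Wolfe method with in face
  directions, for the maximization of \<open>f\<close> over \<open>Q\<close>.  After the method has stopped at a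
  stationary point the iterates stay constant, and \<open>d k\<close> and \<open>a k\<close> are unconstrained.
\<close>
definition FDFW ::
    "('a::real_inner \<Rightarrow> real) \<Rightarrow> 'a set \<Rightarrow> (nat \<Rightarrow> 'a) \<Rightarrow> (nat \<Rightarrow> 'a) \<Rightarrow> (nat \<Rightarrow> real) \<Rightarrow> bool" where
  "FDFW f Q w d a \<longleftrightarrow>
     w 0 \<in> Q \<and>
     (\<forall>k. if stationary f Q (w k) then w (Suc k) = w k
          else fdfw_direction f Q (w k) (d k) \<and>
               0 < a k \<and> a k \<le> max_step Q (w k) (d k) \<and>
               w (Suc k) = w k + a k *\<^sub>R d k)"

section \<open>The defective clique problem\<close>

text \<open>
  The vertex set of a graph is the whole finite type \<open>'n\<close>; the graph is given by its set of
  edges, which are two-element sets of vertices.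
\<close>
definition simple_graph :: "'n set set \<Rightarrow> bool" where
  "simple_graph E \<longleftrightarrow> (\<forall>e\<in>E. card e = 2)"

definition complement_edges :: "'n set set \<Rightarrow> 'n set set" where
  "complement_edges E = {e. card e = 2 \<and> e \<notin> E}"

definition adjacency :: "'n::finite set set \<Rightarrow> real^'n^'n" where
  "adjacency E = (\<chi> i j. if {i, j} \<in> E then 1 else 0)"

text \<open>
  There is no type of vectors indexed by the set \<open>complement_edges E\<close>.  Such vectors are
  represented isometrically by the elements of \<^typ>\<open>real^('n set)\<close> that vanish at every index
  outside \<open>complement_edges E\<close>.  At a feasible point the gradient of \<open>h_obj\<close> below vanishes at
  these indices as well, so it is the gradient with respect to the actual variables.
\<close>
definition relaxed_edge_additions :: "'n::finite set set \<Rightarrow> nat \<Rightarrow> (real^('n set)) set" where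
  "relaxed_edge_additions E s =
     {y. (\<forall>e. e \<notin> complement_edges E \<longrightarrow> y $ e = 0) \<and>
         (\<forall>e\<in>complement_edges E. 0 \<le> y $ e \<and> y $ e \<le> 1) \<and>
         (\<Sum>e\<in>complement_edges E. y $ e) \<le> real s}"

definition added_adjacency :: "'n::finite set set \<Rightarrow> real^('n set) \<Rightarrow> real^'n^'n" where
  "added_adjacency E y = (\<chi> i j. if {i, j} \<in> complement_edges E then y $ {i, j} else 0)"

definition unit_simplex :: "(real^'n::finite) set" where
  "unit_simplex = {x. (\<forall>i. 0 \<le> x $ i) \<and> (\<Sum>i\<in>UNIV. x $ i) = 1}"

definition feasible_set :: "'n::finite set set \<Rightarrow> nat \<Rightarrow> ((real^'n) \<times> (real^('n set))) set" where
  "feasible_set E s = unit_simplex \<times> relaxed_edge_additions E s"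

definition h_obj ::
    "'n::finite set set \<Rightarrow> real \<Rightarrow> real \<Rightarrow> (real^'n) \<times> (real^('n set)) \<Rightarrow> real" where
  "h_obj E \<alpha> \<beta> = (\<lambda>(x, y).
     x \<bullet> ((adjacency E + added_adjacency E y) *v x)
       + \<alpha> / 2 * (norm x)\<^sup>2 + \<beta> / 2 * (norm y)\<^sup>2)"

definition barycenter :: "'n::finite set \<Rightarrow> real^'n" where
  "barycenter C = (1 / real (card C)) *\<^sub>R (\<Sum>i\<in>C. axis i 1)"

definition support :: "real^'n::finite \<Rightarrow> 'n set" where
  "support x = {i. x $ i \<noteq> 0}"

end

theory Submission
  imports Defs
begin

text \<open>
  Let \<open>F\<close> be the face of the polytope on which the gradient at \<open>p\<close> attains its maximum.  Vertices
  outside \<open>F\<close> have a uniformly smaller value, so at an iterate close to \<open>p\<close> but outside \<open>F\<close> the in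
  face direction has slope bounded away from \<open>0\<close>, while the Frank-Wolfe slope is small.  Hence the
  in face direction is chosen; its maximal step is so short that the stepsize condition forces it to
  be taken, which keeps the iterate close to \<open>p\<close> and lowers the dimension of its minimal face.  After
  finitely many such steps the iterate is in \<open>F\<close>, and \<open>F\<close> is not left near \<open>p\<close>.

  For \<open>h_obj\<close> at a strict local maximizer, second-order conditions along edges of the feasible set
  show that \<open>y\<^sub>p\<close> is binary with exactly \<open>s\<close> ones and that \<open>C\<close> is a clique of the extended graph.
  Strict complementarity then gives \<open>F = {x. supp x \<subseteq> C} \<times> {y\<^sub>p}\<close>, where the objective is
  \<open>h_obj p - (1 - \<alpha>/2) (dist z p)\<^sup>2\<close>.  Since the method increases the objective, the distance
  to \<open>p\<close> is nonincreasing from then on.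
\<close>

section \<open>Minimal faces and maximal steps\<close>

lemma minimal_face_face_of:
  assumes "convex Q" "w \<in> Q"
  shows "minimal_face Q w face_of Q"
  unfolding minimal_face_def
  using assms face_of_refl by (intro face_of_Inter) blast+

lemma mem_minimal_face: "w \<in> minimal_face Q w"
  by (auto simp: minimal_face_def)

lemma minimal_face_subset: "F face_of Q \<Longrightarrow> w \<in> F \<Longrightarrow> minimal_face Q w \<subseteq> F"
  by (auto simp: minimal_face_def)

text \<open>The relative frontier of a polytope is the union of its facets. A facet of the minimal
  face that contained \<open>w\<close> would be a smaller face of \<open>Q\<close> containing
  \<open>w\<close>.\<close>

lemma mem_rel_interior_minimal_face:
  fixes Q :: "'a::euclidean_space set"
  assumes "polytope Q" "w \<in> Q"
  shows "w \<in> rel_interior (minimal_face Q w)"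
proof (rule ccontr)
  let ?M = "minimal_face Q w"
  have M: "?M face_of Q"
    using assms by (intro minimal_face_face_of polytope_imp_convex)
  then have poly: "polyhedron ?M"
    using assms face_of_polytope_polytope polytope_imp_polyhedron by blast
  assume "w \<notin> rel_interior ?M"
  then have "w \<in> rel_frontier ?M"
    using mem_minimal_face closure_subset by (fastforce simp: rel_frontier_def)
  then obtain F where F: "F facet_of ?M" "w \<in> F"
    using rel_frontier_of_polyhedron[OF poly] by blast
  then have "?M \<subseteq> F"
    using M facet_of_imp_face_of face_of_trans by (intro minimal_face_subset) blast+
  with F show False
    using facet_of_imp_subset[of F ?M] by auto
qed

text \<open>By Krein-Milman \<open>M\<close> is the convex hull of its extreme points, so these
  cannot all lie in the convex set \<open>F\<close>; extreme points of a face are extreme in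
  \<open>Q\<close>.\<close>

lemma face_extreme_point_outside:
  fixes Q :: "'a::euclidean_space set"
  assumes "polytope Q" "M face_of Q" "convex F" "\<not> M \<subseteq> F"
  obtains v where "v extreme_point_of Q" "v \<in> M" "v \<notin> F"
proof -
  have "polytope M"
    using assms face_of_polytope_polytope by blast
  then have "M = convex hull {v. v extreme_point_of M}"
    by (intro Krein_Milman_Minkowski polytope_imp_compact polytope_imp_convex)
  then have "\<not> {v. v extreme_point_of M} \<subseteq> F"
    using assms(3,4) by (metis hull_minimal)
  then show ?thesis
    using that extreme_point_of_face[OF assms(2)] by blast
qed

lemma exposed_face_gap:
  fixes Q :: "'a::euclidean_space set"
  assumes "polytope Q" "\<And>v. v \<in> Q \<Longrightarrow> g \<bullet> (v - p) \<le> 0"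
  obtains \<eta> where "0 < \<eta>"
    "\<And>v. v extreme_point_of Q \<Longrightarrow> g \<bullet> (v - p) \<noteq> 0 \<Longrightarrow> g \<bullet> (v - p) \<le> - \<eta>"
proof -
  let ?V = "{v. v extreme_point_of Q \<and> g \<bullet> (v - p) \<noteq> 0}"
  \<comment> \<open>The entry \<open>1\<close> keeps the set nonempty when no vertex has a nonzero
    value.\<close>
  let ?S = "insert 1 ((\<lambda>v. - (g \<bullet> (v - p))) ` ?V)"
  have fin: "finite ?S"
    using finite_polyhedron_extreme_points[OF polytope_imp_polyhedron[OF assms(1)]] by auto
  have "0 < - (g \<bullet> (v - p))" if "v \<in> ?V" for v
    using that assms(2)[of v] by (auto simp: extreme_point_of_def)
  then have "0 < Min ?S"
    using fin by (subst Min_gr_iff) auto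
  moreover have "g \<bullet> (v - p) \<le> - Min ?S" if "v extreme_point_of Q" "g \<bullet> (v - p) \<noteq> 0" for v
  proof -
    have "Min ?S \<le> - (g \<bullet> (v - p))"
      using that fin by (intro Min_le) auto
    then show ?thesis
      by linarith
  qed
  ultimately show ?thesis
    using that by blast
qed

text \<open>\<open>GREATEST\<close> is meaningful only if the maximum is attained. For compact
  \<open>Q\<close> and nonzero \<open>d\<close> the feasible steps form a nonempty compact set of
  reals.\<close>

lemma max_step_properties:
  fixes Q :: "'a::real_normed_vector set"
  assumes "compact Q" "w \<in> Q" "d \<noteq> 0"
  shows "0 \<le> max_step Q w d" "w + max_step Q w d *\<^sub>R d \<in> Q"
    and "\<And>t. 0 \<le> t \<Longrightarrow> w + t *\<^sub>R d \<in> Q \<Longrightarrow> t \<le> max_step Q w d"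
proof -
  let ?T = "{t. 0 \<le> t \<and> w + t *\<^sub>R d \<in> Q}"
  obtain B where B: "\<And>x. x \<in> Q \<Longrightarrow> norm x \<le> B"
    using compact_imp_bounded[OF assms(1)] by (auto simp: bounded_iff)
  have "t \<le> 2 * B / norm d" if "t \<in> ?T" for t
  proof -
    have "t * norm d = norm ((w + t *\<^sub>R d) - w)"
      using that by simp
    also have "\<dots> \<le> 2 * B"
      using B[of "w + t *\<^sub>R d"] B[OF assms(2)] norm_triangle_ineq4[of "w + t *\<^sub>R d" w] that by auto
    finally show ?thesis
      using assms(3) by (simp add: field_simps)
  qed
  then have "bounded ?T"
    by (intro bounded_subset[OF bounded_closed_interval[of 0 "2 * B / norm d"]]) auto
  moreover have "closed ?T"
  proof -
    have "closed ((\<lambda>t. w + t *\<^sub>R d) -` Q)"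
      using assms(1) by (intro continuous_closed_vimage compact_imp_closed continuous_intros)
    then have "closed ({0..} \<inter> (\<lambda>t. w + t *\<^sub>R d) -` Q)"
      by (intro closed_Int closed_atLeast)
    then show ?thesis
      by (rule back_subst[of closed]) auto
  qed
  moreover have "?T \<noteq> {}"
    using assms(2) by (auto intro: exI[of _ 0])
  ultimately obtain m where m: "m \<in> ?T" "\<And>t. t \<in> ?T \<Longrightarrow> t \<le> m"
    using compact_attains_sup[of ?T] compact_eq_bounded_closed by blast
  then have "max_step Q w d = m"
    unfolding max_step_def by (intro Greatest_equality) auto
  with m show "0 \<le> max_step Q w d" "w + max_step Q w d *\<^sub>R d \<in> Q"
    "\<And>t. 0 \<le> t \<Longrightarrow> w + t *\<^sub>R d \<in> Q \<Longrightarrow> t \<le> max_step Q w d"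
    by auto
qed

lemma step_in_polytope:
  fixes Q :: "'a::euclidean_space set"
  assumes "convex Q" "compact Q" "w \<in> Q" "0 \<le> a" "a \<le> max_step Q w d"
  shows "w + a *\<^sub>R d \<in> Q"
\<comment> \<open>For \<open>d = 0\<close> every step is feasible and \<open>max_step\<close> is
  unspecified, but then the point does not move.\<close>
proof (cases "d = 0 \<or> a = 0")
  case False
  let ?m = "max_step Q w d"
  have m: "0 < ?m" "w + ?m *\<^sub>R d \<in> Q"
    using False assms max_step_properties[of Q w d] by auto
  have "w + a *\<^sub>R d = (1 - a / ?m) *\<^sub>R w + (a / ?m) *\<^sub>R (w + ?m *\<^sub>R d)"
    using m by (simp add: algebra_simps)
  also have "\<dots> \<in> Q"
    using m assms by (intro convexD) auto
  finally show ?thesis .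
qed (use assms in auto)

text \<open>The point \<open>w\<close> lies strictly between \<open>v\<close> and \<open>w'\<close>,
  so \<open>w'\<close> is in the minimal face of \<open>w\<close>. Were the two minimal faces equal,
  \<open>w'\<close> would be a relative interior point and the segment from \<open>v\<close> could
  be prolonged beyond it, against the maximality of the step. A proper face has smaller
  dimension.\<close>

lemma aff_dim_minimal_face_less:
  fixes Q :: "'a::euclidean_space set"
  assumes "polytope Q" "w \<in> Q" "v \<in> minimal_face Q w" "v \<noteq> w"
    and "0 < max_step Q w (w - v)"
  defines "w' \<equiv> w + max_step Q w (w - v) *\<^sub>R (w - v)"
  shows "aff_dim (minimal_face Q w') < aff_dim (minimal_face Q w)"
proof -
  let ?M = "minimal_face Q w" and ?t = "max_step Q w (w - v)"
  have convex: "convex Q" and compact: "compact Q"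
    using assms(1) by (auto intro: polytope_imp_compact polytope_imp_convex)
  have M: "?M face_of Q"
    using convex assms(2) by (rule minimal_face_face_of)
  have d: "w - v \<noteq> 0"
    using assms(4) by simp
  have w': "w' \<in> Q"
    unfolding w'_def using max_step_properties(2)[OF compact assms(2) d] .
  have "w = (1 - 1 / (1 + ?t)) *\<^sub>R v + (1 / (1 + ?t)) *\<^sub>R w'"
  proof -
    have "(1 + ?t) *\<^sub>R w = ?t *\<^sub>R v + w'"
      by (simp add: w'_def algebra_simps)
    moreover have "w = (1 / (1 + ?t)) *\<^sub>R ((1 + ?t) *\<^sub>R w)"
      using assms(5) by simp
    ultimately have "w = (1 / (1 + ?t)) *\<^sub>R (?t *\<^sub>R v + w')"
      by metis
    moreover have "1 - 1 / (1 + ?t) = ?t / (1 + ?t)"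
      using assms(5) by (simp add: field_simps)
    ultimately show ?thesis
      by (simp add: scaleR_add_right)
  qed
  moreover have "w' \<noteq> v"
  proof
    assume "w' = v"
    then have "(1 + ?t) *\<^sub>R (w - v) = 0"
      by (simp add: w'_def algebra_simps)
    with assms(5) d show False
      by simp
  qed
  ultimately have "w \<in> open_segment v w'"
    unfolding in_segment using assms(5) by (intro conjI exI[of _ "1 / (1 + ?t)"]) (auto simp: field_simps)
  then have "w' \<in> ?M"
    using M face_of_imp_subset[OF M] assms(3) w' mem_minimal_face[of w Q] unfolding face_of_def by blast
  then have sub: "minimal_face Q w' \<subseteq> ?M"
    using M by (intro minimal_face_subset)
  have M': "minimal_face Q w' face_of Q"
    using convex w' by (rule minimal_face_face_of)
  have "minimal_face Q w' \<noteq> ?M"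
  proof
    assume eq: "minimal_face Q w' = ?M"
    have "w' \<in> rel_interior ?M"
      using mem_rel_interior_minimal_face[OF assms(1) w'] by (simp add: eq)
    then obtain e where e: "1 < e" "(1 - e) *\<^sub>R v + e *\<^sub>R w' \<in> ?M"
      using convex_rel_interior_if2[OF face_of_imp_convex[OF M]] assms(3) hull_inc by metis
    \<comment> \<open>Since \<open>w' - v = (1 + t) (w - v)\<close> for the maximal step
      \<open>t\<close>, the prolonged point has parameter \<open>e * (1 + t) - 1\<close> on the ray
      from \<open>w\<close>.\<close>
    have "(1 - e) *\<^sub>R v + e *\<^sub>R w' = w + (e * (1 + ?t) - 1) *\<^sub>R (w - v)"
      by (simp add: w'_def algebra_simps)
    with e have "w + (e * (1 + ?t) - 1) *\<^sub>R (w - v) \<in> Q"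
      using face_of_imp_subset[OF M] by auto
    moreover have "?t < e * (1 + ?t) - 1"
      using mult_strict_right_mono[OF e(1) add_pos_pos[OF zero_less_one assms(5)]] by simp
    ultimately show False
      using max_step_properties(3)[OF compact assms(2) d, of "e * (1 + ?t) - 1"] assms(5) by simp
  qed
  moreover have "minimal_face Q w' face_of ?M"
    using M' sub face_of_imp_subset[OF M] by (rule face_of_subset)
  ultimately show ?thesis
    using face_of_imp_convex[OF M] by (intro face_of_aff_dim_lt)
qed

text \<open>The point \<open>w\<close> competes with \<open>u\<close>, so the Frank-Wolfe slope is
  nonnegative; the in face direction is taken only if its slope is larger.\<close>

lemma fdfw_direction_ascent:
  assumes "fdfw_direction f Q w d" "w \<in> Q"
  shows "0 \<le> grad f w \<bullet> d"
proof -
  obtain u v where u: "is_arg_max (\<lambda>y. grad f w \<bullet> y) (\<lambda>y. y \<in> Q) u"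
    and d: "d = (if grad f w \<bullet> (u - w) \<ge> grad f w \<bullet> (w - v) then u - w else w - v)"
    using assms(1) by (auto simp: fdfw_direction_def)
  have "0 \<le> grad f w \<bullet> (u - w)"
    using u assms(2) by (auto simp: is_arg_max_linorder inner_diff_right)
  then show ?thesis
    by (auto simp: d)
qed

lemma exposed_face_face_of:
  fixes Q :: "'a::euclidean_space set"
  assumes "convex Q" "\<And>v. v \<in> Q \<Longrightarrow> g \<bullet> (v - p) \<le> 0"
  shows "{v \<in> Q. g \<bullet> (v - p) = 0} face_of Q"
proof -
  have "{v \<in> Q. g \<bullet> (v - p) = 0} = Q \<inter> {v. g \<bullet> v = g \<bullet> p}"
    by (auto simp: inner_diff_right)
  then show ?thesis
    using assms face_of_Int_supporting_hyperplane_le[of Q g "g \<bullet> p"] by (simp add: inner_diff_right)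
qed

section \<open>Identification of the critical face\<close>

text \<open>For stationary \<open>p\<close> the value \<open>0\<close> is the maximum of this linear
  function over \<open>Q\<close>, so the set is the exposed face called \<open>F\<close> in the
  overview.\<close>

definition critical_face :: "('a::real_inner \<Rightarrow> real) \<Rightarrow> 'a set \<Rightarrow> 'a \<Rightarrow> 'a set" where
  "critical_face f Q p = {v \<in> Q. grad f p \<bullet> (v - p) = 0}"

lemma critical_face_face_of:
  fixes Q :: "'a::euclidean_space set"
  assumes "convex Q" "stationary f Q p"
  shows "critical_face f Q p face_of Q"
  using assms unfolding critical_face_def stationary_def by (intro exposed_face_face_of) auto

text \<open>Continuity of the gradient costs half of the gap at \<open>p\<close>; finiteness of the
  vertex set makes the neighbourhood independent of the vertex.\<close>

lemma critical_face_gap: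
  fixes Q :: "'a::euclidean_space set"
  assumes "polytope Q" "isCont (grad f) p" "stationary f Q p"
  obtains \<eta> where "0 < \<eta>"
    "\<forall>\<^sub>F z in nhds p. \<forall>v. v extreme_point_of Q \<longrightarrow> v \<notin> critical_face f Q p \<longrightarrow>
       grad f z \<bullet> (v - p) \<le> - \<eta>"
proof -
  have stat: "grad f p \<bullet> (v - p) \<le> 0" if "v \<in> Q" for v
    using assms(3) that by (auto simp: stationary_def)
  obtain \<eta> where \<eta>: "0 < \<eta>"
    "\<And>v. v extreme_point_of Q \<Longrightarrow> grad f p \<bullet> (v - p) \<noteq> 0 \<Longrightarrow> grad f p \<bullet> (v - p) \<le> - \<eta>"
    using exposed_face_gap[OF assms(1) stat] by blast
  have "finite {v. v extreme_point_of Q}"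
    using finite_polyhedron_extreme_points[OF polytope_imp_polyhedron[OF assms(1)]] .
  moreover have "\<forall>\<^sub>F z in nhds p. v \<notin> critical_face f Q p \<longrightarrow> grad f z \<bullet> (v - p) \<le> - (\<eta> / 2)"
    if v: "v extreme_point_of Q" for v
  proof (cases "v \<in> critical_face f Q p")
    case False
    then have "grad f p \<bullet> (v - p) < - (\<eta> / 2)"
      using v \<eta>(1) \<eta>(2)[OF v] by (auto simp: critical_face_def extreme_point_of_def)
    moreover have "((\<lambda>z. grad f z \<bullet> (v - p)) \<longlongrightarrow> grad f p \<bullet> (v - p)) (nhds p)"
      using assms(2) unfolding isCont_def tendsto_at_iff_tendsto_nhds by (intro tendsto_intros)
    ultimately show ?thesis
      by (auto dest!: order_tendstoD(2) elim: eventually_mono)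
  qed auto
  ultimately have "\<forall>\<^sub>F z in nhds p. \<forall>v\<in>{v. v extreme_point_of Q}.
      v \<notin> critical_face f Q p \<longrightarrow> grad f z \<bullet> (v - p) \<le> - (\<eta> / 2)"
    by (intro eventually_ball_finite) auto
  then have "\<forall>\<^sub>F z in nhds p. \<forall>v. v extreme_point_of Q \<longrightarrow> v \<notin> critical_face f Q p \<longrightarrow>
      grad f z \<bullet> (v - p) \<le> - (\<eta> / 2)"
    by simp
  with \<eta>(1) show ?thesis
    by (intro that[of "\<eta> / 2"]) auto
qed

text \<open>Near \<open>p\<close> every vertex outside the face has a smaller linearized value than
  \<open>p\<close>, so the Frank-Wolfe point \<open>u\<close> is in the face; \<open>v\<close> is
  there because the minimal face of \<open>z\<close> is. Either direction is then orthogonal to the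
  gradient at \<open>p\<close>.\<close>

lemma critical_face_invariant:
  fixes Q :: "'a::euclidean_space set"
  assumes "polytope Q" "isCont (grad f) p" "p \<in> Q" "stationary f Q p"
  shows "\<forall>\<^sub>F z in nhds p. \<forall>d a. z \<in> critical_face f Q p \<longrightarrow> fdfw_direction f Q z d \<longrightarrow>
    0 \<le> a \<longrightarrow> a \<le> max_step Q z d \<longrightarrow> z + a *\<^sub>R d \<in> critical_face f Q p"
proof -
  let ?F = "critical_face f Q p"
  have convex: "convex Q" and compact: "compact Q"
    using assms(1) by (auto intro: polytope_imp_compact polytope_imp_convex)
  have F: "?F face_of Q"
    using convex assms(4) by (rule critical_face_face_of)
  obtain \<eta> where \<eta>: "0 < \<eta>"
    "\<forall>\<^sub>F z in nhds p. \<forall>v. v extreme_point_of Q \<longrightarrow> v \<notin> ?F \<longrightarrow> grad f z \<bullet> (v - p) \<le> - \<eta>"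
    using critical_face_gap[OF assms(1,2,4)] .
  show ?thesis
    using \<eta>(2)
  proof (eventually_elim, intro allI impI)
    fix z d a
    assume gap: "\<forall>v. v extreme_point_of Q \<longrightarrow> v \<notin> ?F \<longrightarrow> grad f z \<bullet> (v - p) \<le> - \<eta>"
      and z: "z \<in> ?F" and dir: "fdfw_direction f Q z d" and a: "0 \<le> a" "a \<le> max_step Q z d"
    obtain u v where u: "is_arg_max (\<lambda>y. grad f z \<bullet> y) (\<lambda>y. y \<in> Q) u"
      and v: "is_arg_min (\<lambda>y. grad f z \<bullet> y) (\<lambda>y. y \<in> minimal_face Q z) v"
      and d: "d = u - z \<or> d = z - v"
      using dir unfolding fdfw_direction_def by metis
    have "v \<in> ?F"
      using v minimal_face_subset[OF F z] by (auto simp: is_arg_min_def)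
    moreover have "u \<in> ?F"
    proof (rule ccontr)
      assume "u \<notin> ?F"
      have uQ: "u \<in> Q" "\<And>y. y \<in> Q \<Longrightarrow> grad f z \<bullet> (y - u) \<le> 0"
        using u by (auto simp: is_arg_max_linorder inner_diff_right)
      \<comment> \<open>The maximizer \<open>u\<close> need not be a vertex, but if it is outside
        the critical face, then the face of all maximizers has a vertex outside it.\<close>
      let ?U = "{y \<in> Q. grad f z \<bullet> (y - u) = 0}"
      have U: "?U face_of Q"
        using convex uQ(2) by (rule exposed_face_face_of)
      have "u \<in> ?U"
        using uQ(1) by simp
      with \<open>u \<notin> ?F\<close> obtain x where x: "x extreme_point_of Q" "x \<in> ?U" "x \<notin> ?F"
        using face_extreme_point_outside[OF assms(1) U face_of_imp_convex[OF F]] by blast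
      then have "grad f z \<bullet> (x - p) < 0"
        using gap \<eta>(1) by force
      then show False
        using x(2) uQ(2)[OF assms(3)] by (simp add: inner_diff_right)
    qed
    ultimately have "grad f p \<bullet> d = 0"
      using d z by (auto simp: critical_face_def inner_diff_right)
    moreover have "z + a *\<^sub>R d \<in> Q"
      using step_in_polytope[OF convex compact _ a] z by (auto simp: critical_face_def)
    ultimately show "z + a *\<^sub>R d \<in> ?F"
      using z by (auto simp: critical_face_def inner_diff_right inner_add_right)
  qed
qed

text \<open>The slope at \<open>p\<close> along the in face direction stays at least \<eta> / 2, yet
  no feasible point has a larger linearized value than \<open>p\<close>. So the maximal step is at
  most a multiple of \<open>dist z p\<close>, which close to \<open>p\<close> is below the second
  term of \<open>step_bound\<close>. The stepsize is then maximal and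
  \<open>aff_dim_minimal_face_less\<close> applies.\<close>

lemma fdfw_step_towards_critical_face:
  fixes Q :: "'a::euclidean_space set"
  assumes "polytope Q" "isCont (grad f) p" "p \<in> Q" "stationary f Q p"
    and c: "0 < c" and \<epsilon>: "0 < \<epsilon>"
  shows "\<forall>\<^sub>F z in nhds p. \<forall>d a. z \<in> Q \<longrightarrow> z \<notin> critical_face f Q p \<longrightarrow> fdfw_direction f Q z d \<longrightarrow>
    0 < a \<longrightarrow> a \<le> max_step Q z d \<longrightarrow> step_bound c f Q z d \<le> a \<longrightarrow>
    dist (z + a *\<^sub>R d) p < \<epsilon> \<and>
    aff_dim (minimal_face Q (z + a *\<^sub>R d)) < aff_dim (minimal_face Q z)"
proof -
  let ?F = "critical_face f Q p"
  have convex: "convex Q" and compact: "compact Q"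
    using assms(1) by (auto intro: polytope_imp_compact polytope_imp_convex)
  have F: "?F face_of Q"
    using convex assms(4) by (rule critical_face_face_of)
  have stat: "grad f p \<bullet> (v - p) \<le> 0" if "v \<in> Q" for v
    using assms(4) that by (auto simp: stationary_def)
  obtain \<eta> where \<eta>: "0 < \<eta>"
    "\<forall>\<^sub>F z in nhds p. \<forall>v. v extreme_point_of Q \<longrightarrow> v \<notin> ?F \<longrightarrow> grad f z \<bullet> (v - p) \<le> - \<eta>"
    using critical_face_gap[OF assms(1,2,4)] .
  obtain D where D: "0 < D" "\<And>x y. x \<in> Q \<Longrightarrow> y \<in> Q \<Longrightarrow> norm (x - y) \<le> D"
  proof
    show "0 < diameter Q + 1"
      using diameter_ge_0[OF compact_imp_bounded[OF compact]] by simp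
    show "norm (x - y) \<le> diameter Q + 1" if "x \<in> Q" "y \<in> Q" for x y
      using diameter_bounded_bound[OF compact_imp_bounded[OF compact] that] by (simp add: dist_norm)
  qed
  \<comment> \<open>\<open>G\<close> bounds the gradient norm near \<open>p\<close>. The first entry
    of \<tau> is a lower bound for the second term of \<open>step_bound\<close>; the second entry
    limits the displacement to \<epsilon> / 2.\<close>
  define G where "G = norm (grad f p) + 1"
  define \<tau> where "\<tau> = min (c * \<eta> / (2 * D\<^sup>2)) (\<epsilon> / (2 * D))"
  have G: "0 < G" and \<tau>: "0 < \<tau>"
    using c \<epsilon> \<eta>(1) D(1) by (auto simp: G_def \<tau>_def add_nonneg_pos)
  have E1: "\<forall>\<^sub>F z in nhds p. dist (grad f z) (grad f p) < min 1 (\<eta> / (8 * D))"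
    using assms(2) \<eta>(1) D(1) unfolding isCont_def tendsto_at_iff_tendsto_nhds
    by (intro tendstoD) auto
  have E2: "\<forall>\<^sub>F z in nhds p. dist z p < min (\<epsilon> / 2) (min (\<eta> / (8 * G)) (\<eta> / 2 * \<tau> / G))"
    unfolding eventually_nhds_metric
    using \<epsilon> \<eta>(1) G \<tau> by (intro exI[of _ "min (\<epsilon> / 2) (min (\<eta> / (8 * G)) (\<eta> / 2 * \<tau> / G))"]) simp
  show ?thesis
    using \<eta>(2) E1 E2
  proof (eventually_elim, intro allI impI)
    fix z d a
    assume gap: "\<forall>v. v extreme_point_of Q \<longrightarrow> v \<notin> ?F \<longrightarrow> grad f z \<bullet> (v - p) \<le> - \<eta>"
      and E1: "dist (grad f z) (grad f p) < min 1 (\<eta> / (8 * D))"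
      and E2: "dist z p < min (\<epsilon> / 2) (min (\<eta> / (8 * G)) (\<eta> / 2 * \<tau> / G))"
      and z: "z \<in> Q" "z \<notin> ?F" and dir: "fdfw_direction f Q z d"
      and a: "0 < a" "a \<le> max_step Q z d" "step_bound c f Q z d \<le> a"
    obtain u v where u: "is_arg_max (\<lambda>y. grad f z \<bullet> y) (\<lambda>y. y \<in> Q) u"
      and v: "is_arg_min (\<lambda>y. grad f z \<bullet> y) (\<lambda>y. y \<in> minimal_face Q z) v"
      and d: "d = (if grad f z \<bullet> (u - z) \<ge> grad f z \<bullet> (z - v) then u - z else z - v)"
      using dir by (auto simp: fdfw_direction_def)
    have M: "minimal_face Q z face_of Q"
      using convex z(1) by (rule minimal_face_face_of)
    have uQ: "u \<in> Q" and vM: "v \<in> minimal_face Q z"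
      using u v by (auto simp: is_arg_max_def is_arg_min_def)
    then have vQ: "v \<in> Q"
      using face_of_imp_subset[OF M] by blast
    have pert: "\<bar>(grad f z - grad f p) \<bullet> (x - y)\<bar> \<le> \<eta> / 8" if "x \<in> Q" "y \<in> Q" for x y
    proof -
      have "\<bar>(grad f z - grad f p) \<bullet> (x - y)\<bar> \<le> norm (grad f z - grad f p) * norm (x - y)"
        by (rule Cauchy_Schwarz_ineq2)
      also have "\<dots> \<le> \<eta> / (8 * D) * D"
        using E1 D(2)[OF that] \<eta>(1) D(1) by (intro mult_mono) (auto simp: dist_norm)
      finally show ?thesis
        using D(1) by simp
    qed
    have near: "\<bar>g \<bullet> (z - p)\<bar> \<le> G * dist z p" if "norm g \<le> G" for g
    proof -
      have "\<bar>g \<bullet> (z - p)\<bar> \<le> norm g * norm (z - p)"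
        by (rule Cauchy_Schwarz_ineq2)
      also have "\<dots> \<le> G * norm (z - p)"
        using that by (intro mult_right_mono) auto
      finally show ?thesis
        by (simp add: dist_norm)
    qed
    have "norm (grad f z) \<le> G"
      using E1 norm_triangle_sub[of "grad f z" "grad f p"] by (simp add: G_def dist_norm)
    moreover have Gdist: "G * dist z p \<le> \<eta> / 8" "G * dist z p \<le> \<eta> / 2 * \<tau>"
      using E2 G by (auto simp: field_simps)
    ultimately have gz: "\<bar>grad f z \<bullet> (z - p)\<bar> \<le> \<eta> / 8"
      using near by fastforce
    \<comment> \<open>A vertex of the minimal face outside the critical face bounds the minimum over
      the minimal face; replacing \<open>p\<close> by \<open>z\<close> costs \<eta> / 8 of the
      gap.\<close>
    have "grad f z \<bullet> (z - v) \<ge> 7 * \<eta> / 8"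
    proof -
      obtain x where x: "x extreme_point_of Q" "x \<in> minimal_face Q z" "x \<notin> ?F"
        using face_extreme_point_outside[OF assms(1) M face_of_imp_convex[OF F]] z(2) mem_minimal_face
        by blast
      have "grad f z \<bullet> v \<le> grad f z \<bullet> x"
        using v x(2) by (auto simp: is_arg_min_linorder)
      moreover have "grad f z \<bullet> (x - p) \<le> - \<eta>"
        using gap x by blast
      ultimately show ?thesis
        using gz unfolding inner_diff_right by linarith
    qed
    moreover have "grad f z \<bullet> (u - z) \<le> \<eta> / 4"
      using pert[OF uQ assms(3)] stat[OF uQ] gz
      unfolding inner_diff_right inner_diff_left by linarith
    ultimately have d: "d = z - v" and dz: "grad f z \<bullet> d \<ge> 7 * \<eta> / 8"
      using d \<eta>(1) by auto
    have dp: "grad f p \<bullet> d \<ge> \<eta> / 2"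
      using dz pert[OF z(1) vQ] \<eta>(1) unfolding d inner_diff_left by linarith
    have d0: "d \<noteq> 0"
      using dz \<eta>(1) by auto
    have dD: "norm d \<le> D"
      unfolding d using z(1) vQ by (rule D(2))
    let ?t = "max_step Q z d"
    have t: "0 \<le> ?t" "z + ?t *\<^sub>R d \<in> Q"
      using max_step_properties[OF compact z(1) d0] by auto
    \<comment> \<open>Stationarity of \<open>p\<close>, tested at the end point of the maximal step,
      bounds this step.\<close>
    have "?t * (\<eta> / 2) \<le> ?t * (grad f p \<bullet> d)"
      using t(1) dp by (intro mult_left_mono)
    also have "\<dots> \<le> - (grad f p \<bullet> (z - p))"
      using stat[OF t(2)] by (simp add: inner_diff_right inner_add_right)
    also have "\<dots> \<le> G * dist z p"
      using near[of "grad f p"] by (simp add: G_def)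
    also have "\<dots> \<le> \<eta> / 2 * \<tau>"
      by (rule Gdist)
    finally have t\<tau>: "?t \<le> \<tau>"
      using \<eta>(1) by simp
    \<comment> \<open>This makes the maximal step the smaller term in \<open>step_bound\<close>, so
      \<open>a\<close> has to equal it.\<close>
    have "\<tau> \<le> c * (\<eta> / 2 / D\<^sup>2)"
      by (simp add: \<tau>_def)
    also have "\<dots> \<le> c * ((grad f z \<bullet> d) / (norm d)\<^sup>2)"
      using c \<eta>(1) dz dD d0 by (intro mult_left_mono frac_le power_mono) auto
    finally have "a = ?t"
      using a t\<tau> by (simp add: step_bound_def)
    have "dist (z + a *\<^sub>R d) p \<le> dist z p + a * norm d"
      using a(1) norm_triangle_ineq[of "z - p" "a *\<^sub>R d"] by (simp add: dist_norm algebra_simps)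
    also have "a * norm d \<le> \<epsilon> / (2 * D) * D"
      using \<open>a = ?t\<close> t\<tau> dD a(1) \<epsilon> D(1) by (intro mult_mono) (auto simp: \<tau>_def)
    finally have "dist (z + a *\<^sub>R d) p < \<epsilon>"
      using E2 D(1) by simp
    moreover have "aff_dim (minimal_face Q (z + a *\<^sub>R d)) < aff_dim (minimal_face Q z)"
      using aff_dim_minimal_face_less[OF assms(1) z(1) vM] d0 a(1) \<open>a = ?t\<close> unfolding d by simp
    ultimately show "dist (z + a *\<^sub>R d) p < \<epsilon> \<and>
        aff_dim (minimal_face Q (z + a *\<^sub>R d)) < aff_dim (minimal_face Q z)" ..
  qed
qed

section \<open>Sequences generated by the method\<close>

lemma FDFW_iterate_in:
  fixes Q :: "'a::euclidean_space set"
  assumes "convex Q" "compact Q" "FDFW f Q w d a"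
  shows "w k \<in> Q"
proof (induction k)
  case (Suc k)
  then show ?case
    using assms(3) step_in_polytope[OF assms(1,2) Suc, of "a k" "d k"]
    unfolding FDFW_def by (metis less_imp_le)
qed (use assms(3) in \<open>auto simp: FDFW_def\<close>)

lemma FDFW_stationary_constant:
  assumes "FDFW f Q w d a" "stationary f Q (w k)" "k \<le> j"
  shows "w j = w k"
  using assms(3)
proof (induction rule: dec_induct)
  case (step n)
  then show ?case
    using assms(1,2) unfolding FDFW_def by metis
qed simp

text \<open>The sequence is constant after a stationary iterate, which is then its only limit point.
  As \<open>p\<close> lies in its own critical face, iterates outside that face are not
  stationary.\<close>

lemma FDFW_stationary_limit_point:
  fixes w :: "nat \<Rightarrow> 'a::real_inner"
  assumes "FDFW f Q w d a" "stationary f Q (w k)" "strict_mono r" "(w \<circ> r) \<longlonglongrightarrow> p"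
  shows "w k = p"
proof -
  have "(w \<circ> r) n = w k" if "k \<le> n" for n
    using FDFW_stationary_constant[OF assms(1,2), of "r n"] seq_suble[OF assms(3), of n] that by simp
  then have "\<forall>\<^sub>F n in sequentially. (w \<circ> r) n = w k"
    unfolding eventually_sequentially by blast
  then have "(w \<circ> r) \<longlonglongrightarrow> w k"
    by (rule tendsto_eventually)
  then show ?thesis
    using assms(4) LIMSEQ_unique by blast
qed

lemma FDFW_reaches_critical_face:
  fixes Q :: "'a::euclidean_space set"
  assumes "polytope Q" "isCont (grad f) p" "p \<in> Q" "stationary f Q p"
    and "FDFW f Q w d a" "strict_mono r" "(w \<circ> r) \<longlonglongrightarrow> p" "0 < c"
    and "\<And>k. \<not> stationary f Q (w k) \<Longrightarrow> a k \<ge> step_bound c f Q (w k) (d k)"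
    and "0 < \<epsilon>"
  shows "\<exists>k. w k \<in> critical_face f Q p \<and> dist (w k) p < \<epsilon>"
proof -
  let ?F = "critical_face f Q p"
  have Q: "w k \<in> Q" for k
    using assms(1,5) by (intro FDFW_iterate_in polytope_imp_convex polytope_imp_compact)
  \<comment> \<open>Induction on a bound for the dimension of the minimal face. The neighbourhood
    depends on \<open>n\<close>: from the one for \<open>Suc n\<close>, a step taken outside the
    critical face lands in the one for \<open>n\<close>.\<close>
  have *: "\<forall>\<^sub>F z in nhds p. \<forall>k. w k = z \<longrightarrow> aff_dim (minimal_face Q z) < int n \<longrightarrow>
      (\<exists>j. w j \<in> ?F \<and> dist (w j) p < \<epsilon>)" for n
  proof (induction n)
    case 0
    have "\<not> aff_dim (minimal_face Q z) < 0" for z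
    proof -
      have "aff_dim (minimal_face Q z) \<noteq> -1"
        using mem_minimal_face aff_dim_empty by blast
      then show ?thesis
        using aff_dim_geq[of "minimal_face Q z"] by linarith
    qed
    then show ?case
      by simp
  next
    case (Suc n)
    then obtain \<delta> where \<delta>: "0 < \<delta>"
      "\<And>k. dist (w k) p < \<delta> \<Longrightarrow> aff_dim (minimal_face Q (w k)) < int n \<Longrightarrow>
        (\<exists>j. w j \<in> ?F \<and> dist (w j) p < \<epsilon>)"
      unfolding eventually_nhds_metric by blast
    have "\<forall>\<^sub>F z in nhds p. dist z p < \<epsilon>"
      using assms(10) unfolding eventually_nhds_metric by blast
    with fdfw_step_towards_critical_face[OF assms(1-4,8) \<delta>(1)] show ?case
    proof (eventually_elim, intro allI impI)
      fix z k
      assume step: "\<forall>d a. z \<in> Q \<longrightarrow> z \<notin> ?F \<longrightarrow> fdfw_direction f Q z d \<longrightarrow>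
          0 < a \<longrightarrow> a \<le> max_step Q z d \<longrightarrow> step_bound c f Q z d \<le> a \<longrightarrow>
          dist (z + a *\<^sub>R d) p < \<delta> \<and>
          aff_dim (minimal_face Q (z + a *\<^sub>R d)) < aff_dim (minimal_face Q z)"
        and near: "dist z p < \<epsilon>" and z: "w k = z"
        and dim: "aff_dim (minimal_face Q z) < int (Suc n)"
      show "\<exists>j. w j \<in> ?F \<and> dist (w j) p < \<epsilon>"
      proof (cases "z \<in> ?F")
        case False
        have "\<not> stationary f Q (w k)"
          using FDFW_stationary_limit_point[OF assms(5) _ assms(6,7), of k] False z assms(3)
          by (auto simp: critical_face_def)
        then have "fdfw_direction f Q z (d k)" "0 < a k" "a k \<le> max_step Q z (d k)"
          "w (Suc k) = z + a k *\<^sub>R d k" "step_bound c f Q z (d k) \<le> a k"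
          using assms(5,9) z unfolding FDFW_def by metis+
        moreover have "z \<in> Q"
          using Q[of k] z by simp
        ultimately have "dist (w (Suc k)) p < \<delta>"
          "aff_dim (minimal_face Q (w (Suc k))) < aff_dim (minimal_face Q z)"
          using step False by metis+
        with dim \<delta>(2)[of "Suc k"] show ?thesis
          by simp
      qed (use near z in auto)
    qed
  qed
  have "\<forall>\<^sub>F k in sequentially. \<forall>i. w i = (w \<circ> r) k \<longrightarrow>
      aff_dim (minimal_face Q ((w \<circ> r) k)) < int (nat (aff_dim Q + 1)) \<longrightarrow>
      (\<exists>j. w j \<in> ?F \<and> dist (w j) p < \<epsilon>)"
    using assms(7) * by (rule filterlim_iff[THEN iffD1, rule_format])
  then obtain k where "aff_dim (minimal_face Q (w (r k))) < int (nat (aff_dim Q + 1)) \<longrightarrow>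
      (\<exists>j. w j \<in> ?F \<and> dist (w j) p < \<epsilon>)"
    unfolding eventually_sequentially by (metis comp_apply order_refl)
  \<comment> \<open>Hence the bound \<open>nat (aff_dim Q + 1)\<close> holds for every iterate;
    \<open>aff_dim Q\<close> is at least \<open>-1\<close>, so \<open>nat\<close> truncates
    nothing.\<close>
  moreover have "aff_dim (minimal_face Q (w (r k))) \<le> aff_dim Q"
    using minimal_face_face_of[OF polytope_imp_convex[OF assms(1)] Q]
    by (intro aff_dim_subset face_of_imp_subset)
  ultimately show ?thesis
    using aff_dim_geq[of Q] by simp
qed

text \<open>
  The growth condition makes the distance to \<open>p\<close> nonincreasing as long as the iterates stay on the
  critical face, so the iterates cannot leave the neighbourhood in which the face is invariant.
\<close>
theorem FDFW_converges_in_critical_face: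
  fixes Q :: "'a::euclidean_space set"
  assumes "polytope Q" "isCont (grad f) p" "p \<in> Q" "stationary f Q p"
    and "FDFW f Q w d a" "strict_mono r" "(w \<circ> r) \<longlonglongrightarrow> p" "0 < c" "0 \<le> \<rho>"
    and "\<And>k. \<not> stationary f Q (w k) \<Longrightarrow> a k \<ge> step_bound c f Q (w k) (d k)"
    and "\<And>k. \<not> stationary f Q (w k) \<Longrightarrow>
           f (w k + a k *\<^sub>R d k) - f (w k)
             \<ge> \<rho> * step_bound c f Q (w k) (d k) * (grad f (w k) \<bullet> d k)"
    and growth: "0 < \<kappa>"
      "\<And>v. v \<in> critical_face f Q p \<Longrightarrow> f v = f p - \<kappa> * (dist v p)\<^sup>2"
  shows "w \<longlonglongrightarrow> p" "\<forall>\<^sub>F k in sequentially. w k \<in> critical_face f Q p"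
proof -
  let ?F = "critical_face f Q p"
  have Q: "w k \<in> Q" for k
    using assms(1,5) by (intro FDFW_iterate_in polytope_imp_convex polytope_imp_compact)
  have mono: "f (w k) \<le> f (w (Suc k))" for k
  proof (cases "stationary f Q (w k)")
    case True
    then show ?thesis
      using assms(5) by (auto simp: FDFW_def)
  next
    case False
    then have dir: "fdfw_direction f Q (w k) (d k)" and a: "0 < a k" "a k \<le> max_step Q (w k) (d k)"
      and w: "w (Suc k) = w k + a k *\<^sub>R d k"
      using assms(5) unfolding FDFW_def by metis+
    have g: "0 \<le> grad f (w k) \<bullet> d k"
      using dir Q by (rule fdfw_direction_ascent)
    \<comment> \<open>The maximal step is at least \<open>a k\<close>, hence positive, and the slope
      is nonnegative. The sufficient increase condition therefore makes the objective
      monotone.\<close>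
    then have "0 \<le> step_bound c f Q (w k) (d k)"
      using a assms(8) by (auto simp: step_bound_def)
    then have "0 \<le> \<rho> * step_bound c f Q (w k) (d k) * (grad f (w k) \<bullet> d k)"
      using g assms(9) by simp
    with assms(11)[OF False] show ?thesis
      by (simp add: w)
  qed
  obtain \<epsilon> where \<epsilon>: "0 < \<epsilon>"
    "\<And>z d a. dist z p < \<epsilon> \<Longrightarrow> z \<in> ?F \<Longrightarrow> fdfw_direction f Q z d \<Longrightarrow>
       0 \<le> a \<Longrightarrow> a \<le> max_step Q z d \<Longrightarrow> z + a *\<^sub>R d \<in> ?F"
    using critical_face_invariant[OF assms(1-4)] unfolding eventually_nhds_metric by blast
  obtain K where K: "w K \<in> ?F" "dist (w K) p < \<epsilon>"
    using FDFW_reaches_critical_face[OF assms(1-8,10) \<epsilon>(1)] by blast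
  have stepF: "w (Suc k) \<in> ?F \<and> dist (w (Suc k)) p \<le> dist (w k) p"
    if "w k \<in> ?F" "dist (w k) p < \<epsilon>" for k
  proof -
    have F: "w (Suc k) \<in> ?F"
    proof (cases "stationary f Q (w k)")
      case True
      then show ?thesis
        using assms(5) that by (auto simp: FDFW_def)
    next
      case False
      then have "fdfw_direction f Q (w k) (d k)" "0 < a k" "a k \<le> max_step Q (w k) (d k)"
        "w (Suc k) = w k + a k *\<^sub>R d k"
        using assms(5) unfolding FDFW_def by metis+
      then show ?thesis
        using \<epsilon>(2)[OF that(2,1)] by simp
    qed
    have "\<kappa> * (dist (w (Suc k)) p)\<^sup>2 \<le> \<kappa> * (dist (w k) p)\<^sup>2"
      using mono[of k] growth(2)[OF F] growth(2)[OF that(1)] by simp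
    then have "dist (w (Suc k)) p \<le> dist (w k) p"
      using growth(1) by (simp add: power2_le_iff_abs_le)
    with F show ?thesis ..
  qed
  have inv: "w k \<in> ?F \<and> dist (w k) p < \<epsilon>" if "K \<le> k" for k
    using that
  proof (induction rule: dec_induct)
    case (step n)
    then show ?case
      using stepF by force
  qed (use K in auto)
  then show "\<forall>\<^sub>F k in sequentially. w k \<in> ?F"
    unfolding eventually_sequentially by blast
  have anti: "dist (w k) p \<le> dist (w j) p" if "K \<le> j" "j \<le> k" for j k
    using that(2)
  proof (induction rule: dec_induct)
    case (step n)
    then show ?case
      using inv[of n] \<open>K \<le> j\<close> stepF[of n] by force
  qed simp
  show "w \<longlonglongrightarrow> p"
  proof (rule metric_LIMSEQ_I)
    fix e :: real
    assume "0 < e"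
    then obtain N where N: "\<And>n. N \<le> n \<Longrightarrow> dist (w (r n)) p < e"
      using metric_LIMSEQ_D[OF assms(7)] by auto
    let ?m = "max N K"
    have "K \<le> r ?m"
      using seq_suble[OF assms(6), of ?m] by simp
    then have "dist (w n) p < e" if "r ?m \<le> n" for n
      using anti[OF _ that] N[of ?m] by fastforce
    then show "\<exists>no. \<forall>n\<ge>no. dist (w n) p < e"
      by blast
  qed
qed

section \<open>Derivatives of the objective\<close>

definition graph_matrix :: "'n::finite set set \<Rightarrow> real^('n set) \<Rightarrow> real^'n^'n" where
  "graph_matrix E y = adjacency E + added_adjacency E y"

text \<open>The coefficient vector of the quadratic form as a linear function of \<open>y\<close>.
  The double sum meets an edge in both orders, so the entry at a complement edge
  \<open>{i, j}\<close> is \<open>2 * x $ i * x $ j\<close>.\<close>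

definition edge_weights :: "'n::finite set set \<Rightarrow> real^'n \<Rightarrow> real^('n set)" where
  "edge_weights E x = (\<chi> e. if e \<in> complement_edges E
     then \<Sum>i\<in>UNIV. \<Sum>j\<in>UNIV. if {i, j} = e then x $ i * x $ j else 0 else 0)"

lemma inner_added_adjacency:
  "x \<bullet> (added_adjacency E y *v x) = y \<bullet> edge_weights E x"
proof -
  have "y \<bullet> edge_weights E x = (\<Sum>e\<in>UNIV. \<Sum>i\<in>UNIV. \<Sum>j\<in>UNIV.
      if {i, j} = e then (if e \<in> complement_edges E then y $ e * (x $ i * x $ j) else 0) else 0)"
    unfolding inner_vec_def edge_weights_def
    by (intro sum.cong) (auto simp: sum_distrib_left intro!: sum.cong sum.neutral)
  also have "\<dots> = (\<Sum>i\<in>UNIV. \<Sum>j\<in>UNIV. \<Sum>e\<in>UNIV.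
      if {i, j} = e then (if e \<in> complement_edges E then y $ e * (x $ i * x $ j) else 0) else 0)"
    by (subst sum.swap, rule sum.cong[OF refl], rule sum.swap)
  also have "\<dots> = x \<bullet> (added_adjacency E y *v x)"
    by (auto simp: inner_vec_def matrix_vector_mult_def added_adjacency_def sum_distrib_left
      intro!: sum.cong)
  finally show ?thesis ..
qed

lemma added_adjacency_add:
  "added_adjacency E (y + y') = added_adjacency E y + added_adjacency E y'"
  by (auto simp: added_adjacency_def vec_eq_iff)

lemma added_adjacency_scaleR:
  "added_adjacency E (r *\<^sub>R y) = r *\<^sub>R added_adjacency E y"
  by (auto simp: added_adjacency_def vec_eq_iff)

lemma inner_graph_matrix_commute:
  "x \<bullet> (graph_matrix E y *v x') = x' \<bullet> (graph_matrix E y *v x)"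
proof -
  have "transpose (graph_matrix E y) = graph_matrix E y"
    by (simp add: graph_matrix_def adjacency_def added_adjacency_def transpose_def vec_eq_iff
      insert_commute)
  then have "x \<bullet> (graph_matrix E y *v x') = (graph_matrix E y *v x) \<bullet> x'"
    by (metis dot_lmul_matrix vector_transpose_matrix)
  then show ?thesis
    by (simp add: inner_commute)
qed

lemma h_obj_graph_matrix:
  "h_obj E \<alpha> \<beta> (x, y) = x \<bullet> (graph_matrix E y *v x) + \<alpha> / 2 * (x \<bullet> x) + \<beta> / 2 * (y \<bullet> y)"
  by (simp add: h_obj_def graph_matrix_def power2_norm_eq_inner)

definition h_grad_x :: "'n::finite set set \<Rightarrow> real \<Rightarrow> real^'n \<Rightarrow> real^('n set) \<Rightarrow> real^'n" where
  "h_grad_x E \<alpha> x y = 2 *\<^sub>R (graph_matrix E y *v x) + \<alpha> *\<^sub>R x"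

definition h_grad_y :: "'n::finite set set \<Rightarrow> real \<Rightarrow> real^'n \<Rightarrow> real^('n set) \<Rightarrow> real^('n set)" where
  "h_grad_y E \<beta> x y = edge_weights E x + \<beta> *\<^sub>R y"

text \<open>The objective is jointly cubic but quadratic in each block separately, so the expansions
  in one block are exact. In the other block, \<open>h_obj_expand_y\<close>, the curvature comes
  from the regularizer alone.\<close>

lemma h_obj_expand_x:
  "h_obj E \<alpha> \<beta> ((x, y) + t *\<^sub>R (u, 0)) = h_obj E \<alpha> \<beta> (x, y) + t * (h_grad_x E \<alpha> x y \<bullet> u)
     + t\<^sup>2 * (u \<bullet> (graph_matrix E y *v u) + \<alpha> / 2 * (u \<bullet> u))"
  using inner_graph_matrix_commute[of x E y u]
  by (simp add: h_obj_graph_matrix h_grad_x_def algebra_simps inner_commute power2_eq_square)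

lemma h_obj_expand_y:
  "h_obj E \<alpha> \<beta> ((x, y) + t *\<^sub>R (0, v)) = h_obj E \<alpha> \<beta> (x, y) + t * (h_grad_y E \<beta> x y \<bullet> v)
     + t\<^sup>2 * (\<beta> / 2 * (v \<bullet> v))"
proof -
  have "x \<bullet> (graph_matrix E (y + t *\<^sub>R v) *v x) =
      x \<bullet> (graph_matrix E y *v x) + t * (v \<bullet> edge_weights E x)"
    by (simp add: graph_matrix_def added_adjacency_add added_adjacency_scaleR inner_add_right
      matrix_vector_mult_add_rdistrib inner_added_adjacency flip: scaleR_matrix_vector_assoc)
  then show ?thesis
    by (simp add: h_obj_graph_matrix h_grad_y_def algebra_simps inner_commute power2_eq_square)
qed

lemma bounded_bilinear_added_adjacency:
  "bounded_bilinear (\<lambda>y x. added_adjacency E y *v x)"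
  unfolding bilinear_conv_bounded_bilinear[symmetric] bilinear_def
  by (auto intro!: linearI simp: added_adjacency_add added_adjacency_scaleR
      matrix_vector_mult_add_rdistrib matrix_vector_right_distrib matrix_vector_mult_scaleR
      simp flip: scaleR_matrix_vector_assoc)

lemma grad_h_obj:
  "grad (h_obj E \<alpha> \<beta>) (x, y) = (h_grad_x E \<alpha> x y, h_grad_y E \<beta> x y)"
proof (rule grad_eq)
  \<comment> \<open>Splitting the form into a part with constant matrix and a part bilinear in
    \<open>y\<close> and \<open>x\<close> lets the product rules apply; symmetry of the matrix
    merges the cross terms.\<close>
  have h: "h_obj E \<alpha> \<beta> = (\<lambda>z. fst z \<bullet> (adjacency E *v fst z)
      + fst z \<bullet> (added_adjacency E (snd z) *v fst z)
      + \<alpha> / 2 * (fst z \<bullet> fst z) + \<beta> / 2 * (snd z \<bullet> snd z))"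
    by (rule ext) (auto simp: h_obj_def power2_norm_eq_inner matrix_vector_mult_add_rdistrib
      inner_add_right split: prod.split)
  have lin: "((\<lambda>z. adjacency E *v fst z) has_derivative (\<lambda>w. adjacency E *v fst w)) (at (x, y))"
    by (rule bounded_linear.has_derivative[OF matrix_vector_mul_bounded_linear])
       (auto intro: derivative_intros)
  have bil: "((\<lambda>z. added_adjacency E (snd z) *v fst z) has_derivative
      (\<lambda>w. added_adjacency E y *v fst w + added_adjacency E (snd w) *v x)) (at (x, y))"
    using bounded_bilinear.FDERIV[OF bounded_bilinear_added_adjacency, of snd snd "(x, y)" UNIV fst fst E]
    by (simp add: bounded_linear_imp_has_derivative bounded_linear_fst bounded_linear_snd)
  have eq: "fst w \<bullet> (adjacency E *v x) + x \<bullet> (adjacency E *v fst w)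
      + (fst w \<bullet> (added_adjacency E y *v x)
         + x \<bullet> (added_adjacency E y *v fst w + added_adjacency E (snd w) *v x))
      + \<alpha> / 2 * (fst w \<bullet> x + x \<bullet> fst w) + \<beta> / 2 * (snd w \<bullet> y + y \<bullet> snd w)
      = w \<bullet> (h_grad_x E \<alpha> x y, h_grad_y E \<beta> x y)" for w
    using inner_graph_matrix_commute[of x E y "fst w"]
    by (cases w) (simp add: graph_matrix_def h_grad_x_def h_grad_y_def inner_added_adjacency
      inner_commute algebra_simps)
  show "GDERIV (h_obj E \<alpha> \<beta>) (x, y) :> (h_grad_x E \<alpha> x y, h_grad_y E \<beta> x y)"
    unfolding gderiv_def h eq[symmetric]
    by (rule has_derivative_eq_rhs, (rule lin bil derivative_intros)+) (auto simp: fun_eq_iff algebra_simps)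
qed

lemma isCont_grad_h_obj: "isCont (grad (h_obj E \<alpha> \<beta>)) p"
proof -
  have "grad (h_obj E \<alpha> \<beta>) = (\<lambda>z. (2 *\<^sub>R (adjacency E *v fst z + added_adjacency E (snd z) *v fst z)
      + \<alpha> *\<^sub>R fst z, edge_weights E (fst z) + \<beta> *\<^sub>R snd z))"
    by (rule ext) (auto simp: grad_h_obj h_grad_x_def h_grad_y_def graph_matrix_def
      matrix_vector_mult_add_rdistrib split: prod.split)
  moreover have "isCont (\<lambda>z. edge_weights E (fst z)) p"
    unfolding edge_weights_def isCont_def
    by (intro tendsto_vec_lambda) (auto intro!: tendsto_intros)
  moreover have "isCont (\<lambda>z. adjacency E *v fst z) p"
    by (intro bounded_linear.isCont[OF matrix_vector_mul_bounded_linear] continuous_intros)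
  moreover have "isCont (\<lambda>z. added_adjacency E (snd z) *v fst z) p"
    by (intro bounded_bilinear.continuous[OF bounded_bilinear_added_adjacency] continuous_intros)
  ultimately show ?thesis
    by (simp only:) (intro continuous_intros)
qed

section \<open>Polyhedral form of the feasible set\<close>

lemma unit_simplex_le_1: "x \<in> unit_simplex \<Longrightarrow> x $ i \<le> 1"
  using member_le_sum[of i UNIV "($) x"] by (simp add: unit_simplex_def)

lemma polytope_unit_simplex: "polytope (unit_simplex :: (real^'n::finite) set)"
proof -
  have "x \<in> unit_simplex \<longleftrightarrow> x \<in> cbox 0 1 \<inter> {x. 1 \<bullet> x = 1}" for x :: "real^'n"
    using unit_simplex_le_1[of x] by (auto simp: unit_simplex_def mem_box_cart inner_vec_def)
  then have "unit_simplex = cbox 0 1 \<inter> {x :: real^'n. 1 \<bullet> x = 1}"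
    by blast
  moreover have "polytope (cbox 0 1 \<inter> {x :: real^'n. 1 \<bullet> x = 1})"
    unfolding polytope_eq_bounded_polyhedron
    by (auto intro: bounded_subset[OF bounded_cbox] polyhedron_hyperplane)
  ultimately show ?thesis
    by simp
qed

lemma polytope_relaxed_edge_additions: "polytope (relaxed_edge_additions E s)"
proof -
  \<comment> \<open>The indicator of the complement edges is both the upper corner of the box,
    forcing zeros elsewhere, and the normal of the budget halfspace.\<close>
  let ?b = "\<chi> e. if e \<in> complement_edges E then 1 else 0"
  have "?b \<bullet> y = (\<Sum>e\<in>complement_edges E. y $ e)" for y :: "real^('a set)"
    by (simp add: inner_vec_def if_distrib[of "\<lambda>r. r * _"] sum.If_cases cong: if_cong)
  then have "relaxed_edge_additions E s = cbox 0 ?b \<inter> {y. ?b \<bullet> y \<le> real s}"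
    by (fastforce simp: relaxed_edge_additions_def mem_box_cart split: if_splits)
  moreover have "polytope (cbox 0 ?b \<inter> {y. ?b \<bullet> y \<le> real s})"
    unfolding polytope_eq_bounded_polyhedron
    by (auto intro: bounded_subset[OF bounded_cbox] polyhedron_halfspace_le)
  ultimately show ?thesis
    by simp
qed

lemma polytope_feasible_set: "polytope (feasible_set E s)"
  unfolding feasible_set_def
  using polytope_unit_simplex polytope_relaxed_edge_additions by (rule polytope_Times)

section \<open>Optimality conditions along a line\<close>

text \<open>Strict maximality gives \<open>L + t * K < 0\<close> for all small positive
  \<open>t\<close>. The limit yields the first claim; for nonnegative \<open>K\<close> a single such
  \<open>t\<close> yields the second.\<close>

lemma strict_local_maximizer_quadratic:
  assumes "p \<in> strict_local_maximizers f Q" "v \<noteq> 0" "0 < \<epsilon>"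
    and "\<And>t. 0 < t \<Longrightarrow> t < \<epsilon> \<Longrightarrow> p + t *\<^sub>R v \<in> Q"
    and "\<And>t. f (p + t *\<^sub>R v) = f p + t * L + t\<^sup>2 * K"
  shows "L \<le> 0" "0 \<le> K \<Longrightarrow> L < 0"
proof -
  obtain \<delta> where \<delta>: "0 < \<delta>" "\<And>w. w \<in> Q \<Longrightarrow> w \<noteq> p \<Longrightarrow> dist w p < \<delta> \<Longrightarrow> f w < f p"
    using assms(1) unfolding strict_local_maximizers_def eventually_at by blast
  have neg: "L + t * K < 0" if t: "0 < t" "t < min \<epsilon> (\<delta> / norm v)" for t
  proof -
    have "f (p + t *\<^sub>R v) < f p"
      using t assms(2-4) by (intro \<delta>(2)) (auto simp: dist_norm field_simps)
    then have "t * (L + t * K) < 0"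
      by (simp add: assms(5) algebra_simps power2_eq_square)
    with t show ?thesis
      by (simp add: mult_less_0_iff)
  qed
  have b: "0 < min \<epsilon> (\<delta> / norm v)"
    using assms(2,3) \<delta>(1) by simp
  have "((\<lambda>t. L + t * K) \<longlongrightarrow> L + 0 * K) (at_right 0)"
    by (intro tendsto_intros)
  moreover have "\<forall>\<^sub>F t in at_right 0. L + t * K \<le> 0"
    unfolding eventually_at_right_field using b neg less_imp_le by blast
  ultimately show "L \<le> 0"
    using tendsto_upperbound[of "\<lambda>t. L + t * K" "L + 0 * K" "at_right (0::real)" 0] by simp
  assume "0 \<le> K"
  moreover obtain t where t: "0 < t" "t < min \<epsilon> (\<delta> / norm v)"
    using b dense by blast
  ultimately have "0 \<le> t * K"
    by simp
  with neg[OF t] show "L < 0"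
    by linarith
qed

text \<open>Applied to \<open>v\<close> and \<open>- v\<close>, the previous lemma makes both
  \<open>L\<close> and \<open>- L\<close> negative: a strict local maximizer is never inside a
  feasible segment on which the objective is convex.\<close>

lemma strict_local_maximizer_two_sided:
  assumes "p \<in> strict_local_maximizers f Q" "v \<noteq> 0" "0 < \<epsilon>" "0 \<le> K"
    and "\<And>t. \<bar>t\<bar> < \<epsilon> \<Longrightarrow> p + t *\<^sub>R v \<in> Q"
    and "\<And>t. f (p + t *\<^sub>R v) = f p + t * L + t\<^sup>2 * K"
  shows False
proof -
  have "L < 0"
    using strict_local_maximizer_quadratic(2)[OF assms(1-3) _ assms(6,4)] assms(5) by simp
  moreover have "- L < 0"
  proof (rule strict_local_maximizer_quadratic(2)[OF assms(1) _ assms(3)])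
    show "p + t *\<^sub>R (- v) \<in> Q" if "0 < t" "t < \<epsilon>" for t
      using assms(5)[of "- t"] that by simp
    show "f (p + t *\<^sub>R (- v)) = f p + t * - L + t\<^sup>2 * K" for t
      using assms(6)[of "- t"] by simp
  qed (use assms in auto)
  ultimately show False
    by simp
qed

section \<open>Strict local maximizers at a barycenter\<close>

lemma barycenter_nth: "barycenter C $ i = (if i \<in> C then 1 / real (card C) else 0)"
  by (simp add: barycenter_def axis_def sum.delta if_distrib cong: if_cong)

lemma inner_barycenter: "x \<bullet> barycenter C = (\<Sum>i\<in>C. x $ i) / real (card C)"
  by (simp add: barycenter_def inner_sum_right inner_axis)

lemma graph_matrix_diag:
  assumes "simple_graph E"
  shows "graph_matrix E y $ i $ i = 0"
  using assms by (auto simp: graph_matrix_def adjacency_def added_adjacency_def simple_graph_def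
    complement_edges_def)

lemma graph_matrix_binary:
  assumes "\<And>e. e \<in> complement_edges E \<Longrightarrow> y $ e = 0 \<or> y $ e = 1"
  shows "graph_matrix E y $ i $ j = 0 \<or> graph_matrix E y $ i $ j = 1"
  using assms by (auto simp: graph_matrix_def adjacency_def added_adjacency_def complement_edges_def)

lemma edge_weights_nonneg:
  assumes "\<And>i. 0 \<le> x $ i"
  shows "0 \<le> edge_weights E x $ e"
  using assms by (auto simp: edge_weights_def intro!: sum_nonneg)

lemma sum_axis:
  "finite A \<Longrightarrow> (\<Sum>j\<in>A. (axis i 1 :: real^'n::finite) $ j) = (if i \<in> A then 1 else 0)"
  by (simp add: axis_def)

lemma sum_add_scaleR_nth:
  fixes u v :: "real^'n::finite"
  shows "(\<Sum>i\<in>A. (u + t *\<^sub>R v) $ i) = (\<Sum>i\<in>A. u $ i) + t * (\<Sum>i\<in>A. v $ i)"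
  by (simp add: sum.distrib sum_distrib_left)

text \<open>The setting at the limit point. That \<open>y\<close> is binary and \<open>C\<close> a
  clique of the extended graph is derived from maximality in \<open>y_binary\<close> and
  \<open>clique\<close>.\<close>

locale barycentric_maximizer =
  fixes E :: "'n::finite set set" and s :: nat and \<alpha> \<beta> :: real
    and C :: "'n set" and y :: "real^('n set)"
  assumes simple: "simple_graph E"
    and s_le: "s \<le> card (complement_edges E)"
    and \<alpha>: "0 < \<alpha>" "\<alpha> < 2" and \<beta>: "0 < \<beta>"
    and C: "C \<noteq> {}"
    and maximizer: "(barycenter C, y) \<in> strict_local_maximizers (h_obj E \<alpha> \<beta>) (feasible_set E s)"
begin

abbreviation "b \<equiv> barycenter C"
abbreviation "N \<equiv> real (card C)"
abbreviation "M \<equiv> graph_matrix E y"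
abbreviation "gx \<equiv> h_grad_x E \<alpha> b y"
abbreviation "gy \<equiv> h_grad_y E \<beta> b y"
abbreviation "Y \<equiv> relaxed_edge_additions E s"

lemma N_pos: "0 < N"
  using C by (simp add: card_gt_0_iff)

lemma feasible: "b \<in> unit_simplex" "y \<in> Y"
  using maximizer by (auto simp: strict_local_maximizers_def feasible_set_def)

text \<open>The feasible set is a product, so one block can move while the other is fixed. Adding
  this condition and \<open>gy_nonpos\<close> gives stationarity.\<close>

lemma gx_nonpos:
  assumes "x \<in> unit_simplex"
  shows "gx \<bullet> (x - b) \<le> 0"
proof (cases "x = b")
  case False
  show ?thesis
  proof (rule strict_local_maximizer_quadratic(1)[OF maximizer _ zero_less_one])
    show "(b, y) + t *\<^sub>R (x - b, 0) \<in> feasible_set E s" if "0 < t" "t < 1" for t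
    proof -
      have "b + t *\<^sub>R (x - b) = (1 - t) *\<^sub>R b + t *\<^sub>R x"
        by (simp add: algebra_simps)
      also have "\<dots> \<in> unit_simplex"
        using polytope_imp_convex[OF polytope_unit_simplex] feasible(1) assms that
        by (intro convexD) auto
      finally show ?thesis
        using feasible(2) by (simp add: feasible_set_def)
    qed
    show "h_obj E \<alpha> \<beta> ((b, y) + t *\<^sub>R (x - b, 0)) = h_obj E \<alpha> \<beta> (b, y)
        + t * (gx \<bullet> (x - b)) + t\<^sup>2 * ((x - b) \<bullet> (M *v (x - b)) + \<alpha> / 2 * ((x - b) \<bullet> (x - b)))" for t
      by (rule h_obj_expand_x)
  qed (use False in \<open>simp add: zero_prod_def\<close>)
qed simp

lemma gy_nonpos:
  assumes "y' \<in> Y"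
  shows "gy \<bullet> (y' - y) \<le> 0"
proof (cases "y' = y")
  case False
  show ?thesis
  proof (rule strict_local_maximizer_quadratic(1)[OF maximizer _ zero_less_one])
    show "(b, y) + t *\<^sub>R (0, y' - y) \<in> feasible_set E s" if "0 < t" "t < 1" for t
    proof -
      have "y + t *\<^sub>R (y' - y) = (1 - t) *\<^sub>R y + t *\<^sub>R y'"
        by (simp add: algebra_simps)
      also have "\<dots> \<in> Y"
        using polytope_imp_convex[OF polytope_relaxed_edge_additions] feasible(2) assms that
        by (intro convexD) auto
      finally show ?thesis
        using feasible(1) by (simp add: feasible_set_def)
    qed
    show "h_obj E \<alpha> \<beta> ((b, y) + t *\<^sub>R (0, y' - y)) = h_obj E \<alpha> \<beta> (b, y)
        + t * (gy \<bullet> (y' - y)) + t\<^sup>2 * (\<beta> / 2 * ((y' - y) \<bullet> (y' - y)))" for t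
      by (rule h_obj_expand_y)
  qed (use False in \<open>simp add: zero_prod_def\<close>)
qed simp

lemma stationary: "stationary (h_obj E \<alpha> \<beta>) (feasible_set E s) (b, y)"
  using gx_nonpos gy_nonpos by (fastforce simp: stationary_def grad_h_obj feasible_set_def)

text \<open>With budget left, some entry could be increased. The slope there is an edge weight plus
  \<open>\<beta> * y $ e\<close>, hence nonnegative, and the curvature is nonnegative, against
  strict maximality.\<close>

lemma sum_y: "(\<Sum>e\<in>complement_edges E. y $ e) = real s"
proof (rule ccontr)
  assume "(\<Sum>e\<in>complement_edges E. y $ e) \<noteq> real s"
  then have less: "(\<Sum>e\<in>complement_edges E. y $ e) < real s"
    using feasible(2) by (simp add: relaxed_edge_additions_def)
  have "\<not> (\<forall>e\<in>complement_edges E. 1 \<le> y $ e)"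
  proof
    assume "\<forall>e\<in>complement_edges E. 1 \<le> y $ e"
    then have "(\<Sum>e\<in>complement_edges E. 1) \<le> (\<Sum>e\<in>complement_edges E. y $ e)"
      by (intro sum_mono) auto
    with less s_le show False
      by simp
  qed
  then obtain e where e: "e \<in> complement_edges E" "y $ e < 1"
    by force
  let ?v = "axis e 1 :: real^('n set)"
  let ?\<epsilon> = "min (1 - y $ e) (real s - (\<Sum>e\<in>complement_edges E. y $ e))"
  have "gy \<bullet> ?v < 0"
  proof (rule strict_local_maximizer_quadratic(2)[OF maximizer])
    show "(b, y) + t *\<^sub>R (0, ?v) \<in> feasible_set E s" if "0 < t" "t < ?\<epsilon>" for t
    proof -
      have "(\<Sum>e'\<in>complement_edges E. (y + t *\<^sub>R ?v) $ e') =
          (\<Sum>e'\<in>complement_edges E. y $ e') + t"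
        using e(1) by (simp only: sum_add_scaleR_nth) (simp add: sum_axis)
      with that e feasible show ?thesis
        by (auto simp: feasible_set_def relaxed_edge_additions_def axis_def)
    qed
    show "h_obj E \<alpha> \<beta> ((b, y) + t *\<^sub>R (0, ?v)) =
        h_obj E \<alpha> \<beta> (b, y) + t * (gy \<bullet> ?v) + t\<^sup>2 * (\<beta> / 2 * (?v \<bullet> ?v))" for t
      by (rule h_obj_expand_y)
  qed (use e less \<beta> in \<open>auto simp: zero_prod_def axis_eq_0_iff\<close>)
  moreover have "0 \<le> gy \<bullet> ?v"
    using edge_weights_nonneg[of b E e] feasible e(1) \<beta>
    by (auto simp: h_grad_y_def inner_axis unit_simplex_def relaxed_edge_additions_def)
  ultimately show False
    by simp
qed

text \<open>The entries sum to the integer \<open>s\<close>, so one fractional entry forces another.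
  Shifting weight between the two is feasible in both directions and the objective is convex along
  it.\<close>

lemma y_binary:
  assumes "e \<in> complement_edges E"
  shows "y $ e = 0 \<or> y $ e = 1"
proof (rule ccontr)
  assume "\<not> ?thesis"
  then have e: "0 < y $ e" "y $ e < 1"
    using assms feasible(2) by (auto simp: relaxed_edge_additions_def less_le)
  have "\<exists>e'\<in>complement_edges E - {e}. y $ e' \<noteq> 0 \<and> y $ e' \<noteq> 1"
  proof (rule ccontr)
    assume "\<not> ?thesis"
    then have "(\<Sum>e'\<in>complement_edges E - {e}. y $ e') =
        (\<Sum>e'\<in>complement_edges E - {e}. if y $ e' = 1 then 1 else 0)"
      by (intro sum.cong) auto
    also have "\<dots> = real (card {e' \<in> complement_edges E - {e}. y $ e' = 1})"
      by (simp flip: sum.inter_filter)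
    finally obtain k where k: "(\<Sum>e'\<in>complement_edges E - {e}. y $ e') = real k"
      by blast
    have "real s = y $ e + real k"
      using sum.remove[OF _ assms, of "($) y"] sum_y k by simp
    with e have "real k < real s" "real s < real (Suc k)"
      by simp_all
    then show False
      unfolding of_nat_less_iff by simp
  qed
  then obtain e' where e': "e' \<in> complement_edges E" "e' \<noteq> e" "0 < y $ e'" "y $ e' < 1"
    using feasible(2) by (auto simp: relaxed_edge_additions_def less_le)
  let ?v = "axis e 1 - axis e' 1 :: real^('n set)"
  let ?\<epsilon> = "min (min (y $ e) (1 - y $ e)) (min (y $ e') (1 - y $ e'))"
  show False
  proof (rule strict_local_maximizer_two_sided[OF maximizer])
    show "(b, y) + t *\<^sub>R (0, ?v) \<in> feasible_set E s" if "\<bar>t\<bar> < ?\<epsilon>" for t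
    proof -
      have "(\<Sum>e''\<in>complement_edges E. (y + t *\<^sub>R ?v) $ e'') =
          (\<Sum>e''\<in>complement_edges E. y $ e'')"
        using e'(1) assms
        by (simp only: sum_add_scaleR_nth) (simp add: sum_subtractf sum_axis)
      with that e e' assms feasible show ?thesis
        by (auto simp: feasible_set_def relaxed_edge_additions_def axis_def abs_if split: if_splits)
    qed
    show "h_obj E \<alpha> \<beta> ((b, y) + t *\<^sub>R (0, ?v)) =
        h_obj E \<alpha> \<beta> (b, y) + t * (gy \<bullet> ?v) + t\<^sup>2 * (\<beta> / 2 * (?v \<bullet> ?v))" for t
      by (rule h_obj_expand_y)
    show "(0, ?v) \<noteq> (0 :: (real^'n) \<times> (real^('n set)))"
      using e'(2) by (auto simp: zero_prod_def axis_eq_axis)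
  qed (use e e' \<beta> in auto)
qed

text \<open>For nonadjacent \<open>i\<close> and \<open>j\<close> the quadratic form of the matrix
  vanishes on \<open>axis i 1 - axis j 1\<close>. The regularizer makes the objective convex along
  this direction, which is feasible both ways since both weights are positive.\<close>

lemma clique:
  assumes "i \<in> C" "j \<in> C" "i \<noteq> j"
  shows "M $ i $ j = 1"
proof (rule ccontr)
  assume "M $ i $ j \<noteq> 1"
  then have "M $ i $ j = 0"
    using graph_matrix_binary y_binary by blast
  moreover have "M $ j $ i = M $ i $ j"
    by (simp add: graph_matrix_def adjacency_def added_adjacency_def insert_commute)
  moreover have "M $ i $ i = 0" "M $ j $ j = 0"
    using simple by (simp_all add: graph_matrix_diag)
  moreover let ?v = "axis i 1 - axis j 1 :: real^'n"
  have "M *v ?v = column i M - column j M"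
    by (simp add: matrix_vector_mult_diff_distrib matrix_vector_mult_basis)
  ultimately have q: "?v \<bullet> (M *v ?v) = 0"
    by (simp add: inner_diff_left inner_axis' column_def)
  show False
  proof (rule strict_local_maximizer_two_sided[OF maximizer])
    show "(b, y) + t *\<^sub>R (?v, 0) \<in> feasible_set E s" if "\<bar>t\<bar> < 1 / N" for t
    proof -
      have "(\<Sum>k\<in>UNIV. (b + t *\<^sub>R ?v) $ k) = (\<Sum>k\<in>UNIV. b $ k)"
        by (simp only: sum_add_scaleR_nth) (simp add: sum_subtractf sum_axis)
      with that assms feasible show ?thesis
        by (auto simp: feasible_set_def unit_simplex_def barycenter_nth axis_def)
    qed
    show "h_obj E \<alpha> \<beta> ((b, y) + t *\<^sub>R (?v, 0)) =
        h_obj E \<alpha> \<beta> (b, y) + t * (gx \<bullet> ?v) + t\<^sup>2 * (?v \<bullet> (M *v ?v) + \<alpha> / 2 * (?v \<bullet> ?v))" for t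
      by (rule h_obj_expand_x)
    show "(?v, 0) \<noteq> (0 :: (real^'n) \<times> (real^('n set)))"
      using assms(3) by (auto simp: zero_prod_def axis_eq_axis)
    show "0 \<le> ?v \<bullet> (M *v ?v) + \<alpha> / 2 * (?v \<bullet> ?v)"
      unfolding q using \<alpha> by simp
  qed (use N_pos in auto)
qed

section \<open>Strict complementarity\<close>

lemma gx_nth: "gx $ i = (2 * (\<Sum>j\<in>C. M $ i $ j) + (if i \<in> C then \<alpha> else 0)) / N"
proof -
  have "(M *v b) $ i = (\<Sum>j\<in>UNIV. if j \<in> C then M $ i $ j / N else 0)"
    by (auto simp: matrix_vector_mult_def barycenter_nth intro!: sum.cong)
  also have "\<dots> = (\<Sum>j\<in>C. M $ i $ j) / N"
    by (simp add: sum.If_cases sum_divide_distrib)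
  finally show ?thesis
    by (simp add: h_grad_x_def barycenter_nth add_divide_distrib)
qed

text \<open>On \<open>C\<close> the matrix is the all-ones matrix minus the identity.\<close>

lemma clique_row_sum:
  assumes "i \<in> C"
  shows "(\<Sum>j\<in>C. M $ i $ j * x $ j) = (\<Sum>j\<in>C. x $ j) - x $ i"
proof -
  have "(\<Sum>j\<in>C. M $ i $ j * x $ j) = (\<Sum>j\<in>C - {i}. M $ i $ j * x $ j)"
    using assms simple by (simp add: sum.remove graph_matrix_diag)
  also have "\<dots> = (\<Sum>j\<in>C - {i}. x $ j)"
    using assms clique by (intro sum.cong) auto
  finally show ?thesis
    using assms by (simp add: sum_diff1)
qed

text \<open>The multiplier of the simplex constraint: the common value of the gradient on
  \<open>C\<close>.\<close>

abbreviation "\<mu> \<equiv> (2 * (N - 1) + \<alpha>) / N"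

lemma gx_inside: "i \<in> C \<Longrightarrow> gx $ i = \<mu>"
  using clique_row_sum[of i "1 :: real^'n"] by (simp add: gx_nth)

text \<open>Let \<open>k\<close> count the neighbours of \<open>i\<close> in \<open>C\<close>. The
  first-order condition and \<alpha> < 2 give \<open>k < N\<close>, so \<open>k \<le> N - 1\<close>
  by integrality; now 0 < \<alpha> makes the inequality strict.\<close>

lemma gx_outside:
  assumes "i \<notin> C"
  shows "gx $ i < \<mu>"
proof -
  have "(\<Sum>j\<in>C. M $ i $ j) = (\<Sum>j\<in>C. if M $ i $ j = 1 then 1 else 0)"
    using graph_matrix_binary y_binary by (intro sum.cong) auto
  also have "\<dots> = real (card {j \<in> C. M $ i $ j = 1})"
    by (simp flip: sum.inter_filter)
  finally obtain k where k: "(\<Sum>j\<in>C. M $ i $ j) = real k"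
    by blast
  have "gx \<bullet> b = \<mu>"
    using N_pos by (simp add: inner_barycenter gx_inside)
  moreover have "axis i 1 \<in> unit_simplex"
    by (simp add: unit_simplex_def axis_def)
  ultimately have "gx $ i \<le> \<mu>"
    using gx_nonpos[of "axis i 1"] by (simp add: inner_diff_right inner_axis)
  then have "2 * real k \<le> 2 * (N - 1) + \<alpha>"
    using N_pos assms by (simp add: gx_nth k divide_le_cancel)
  with \<alpha> have "2 * real k < 2 * N"
    by argo
  then have "real (Suc k) \<le> N"
    unfolding of_nat_le_iff by simp
  then have "2 * real k < 2 * (N - 1) + \<alpha>"
    using \<alpha> by simp
  then show ?thesis
    using N_pos assms by (simp add: gx_nth k divide_strict_right_mono)
qed

text \<open>The hypothesis says that the nonnegative terms \<open>(\<mu> - gx $ i) * x $ i\<close>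
  sum to zero; outside \<open>C\<close> the first factor is positive.\<close>

lemma support_subset:
  assumes "x \<in> unit_simplex" "gx \<bullet> (x - b) = 0"
  shows "support x \<subseteq> C"
proof -
  have "gx \<bullet> b = \<mu>"
    using N_pos by (simp add: inner_barycenter gx_inside)
  moreover have "(\<Sum>i\<in>UNIV. \<mu> * x $ i) = \<mu>"
    using assms(1) unfolding sum_distrib_left[symmetric] by (simp add: unit_simplex_def)
  moreover have "(\<Sum>i\<in>UNIV. (\<mu> - gx $ i) * x $ i) = (\<Sum>i\<in>UNIV. \<mu> * x $ i) - gx \<bullet> x"
    by (simp only: inner_vec_def inner_real_def left_diff_distrib sum_subtractf)
  ultimately have "(\<Sum>i\<in>UNIV. (\<mu> - gx $ i) * x $ i) = 0"
    using assms(2) by (simp only: inner_diff_right)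
  moreover have nonneg: "0 \<le> (\<mu> - gx $ i) * x $ i" for i
    using assms(1) gx_inside[of i] gx_outside[of i]
    by (cases "i \<in> C") (auto simp: unit_simplex_def intro!: mult_nonneg_nonneg)
  ultimately have "(\<mu> - gx $ i) * x $ i = 0" for i
    using sum_nonneg_eq_0_iff[of UNIV "\<lambda>i. (\<mu> - gx $ i) * x $ i"] by simp
  then show ?thesis
    using gx_outside by (force simp: support_def)
qed

text \<open>The endpoints of an edge that was not added are not both in \<open>C\<close>, by
  \<open>clique\<close>, so its edge weight at the barycenter is zero.\<close>

lemma gy_nth:
  assumes "e \<in> complement_edges E"
  shows "y $ e = 1 \<Longrightarrow> \<beta> \<le> gy $ e" "y $ e = 0 \<Longrightarrow> gy $ e = 0"
proof -
  show "\<beta> \<le> gy $ e" if "y $ e = 1"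
    using that edge_weights_nonneg[of b E e] feasible(1) by (simp add: h_grad_y_def unit_simplex_def)
  show "gy $ e = 0" if "y $ e = 0"
  proof -
    have "b $ i * b $ j = 0" if e: "{i, j} = e" for i j
    proof -
      have "i \<noteq> j"
        using assms e by (auto simp: complement_edges_def)
      moreover have "M $ i $ j = 0"
        using assms e \<open>y $ e = 0\<close>
        by (simp add: graph_matrix_def adjacency_def added_adjacency_def complement_edges_def)
      ultimately have "\<not> (i \<in> C \<and> j \<in> C)"
        using clique by force
      then show ?thesis
        by (auto simp: barycenter_nth)
    qed
    then have "edge_weights E b $ e = 0"
      by (auto simp: edge_weights_def intro!: sum.neutral)
    with that show ?thesis
      by (simp add: h_grad_y_def)
  qed
qed

text \<open>Positive slopes keep the entries equal to \<open>1\<close> fixed. At the zero entries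
  the slope vanishes, so there the budget decides: the ones already use all of
  \<open>s\<close>.\<close>

lemma eq_y:
  assumes "y' \<in> Y" "gy \<bullet> (y' - y) = 0"
  shows "y' = y"
proof -
  let ?K = "complement_edges E"
  have outside: "y' $ e = 0" "y $ e = 0" if "e \<notin> ?K" for e
    using that assms(1) feasible(2) by (auto simp: relaxed_edge_additions_def)
  have bounds: "0 \<le> y' $ e" "y' $ e \<le> 1" for e
    using assms(1) outside by (cases "e \<in> ?K"; force simp: relaxed_edge_additions_def)+
  have nonneg: "0 \<le> gy $ e * (y $ e - y' $ e)" for e
  proof (cases "e \<in> ?K \<and> y $ e = 1")
    case True
    then show ?thesis
      using gy_nth(1) bounds \<beta> by (intro mult_nonneg_nonneg) (force intro: order_trans[of 0 \<beta>])+
  next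
    case False
    then show ?thesis
      using y_binary[of e] gy_nth(2)[of e] outside[of e] by (cases "e \<in> ?K") auto
  qed
  have "(\<Sum>e\<in>UNIV. gy $ e * (y $ e - y' $ e)) = 0"
    using assms(2) by (simp add: inner_diff_right inner_vec_def right_diff_distrib sum_subtractf)
  then have zero: "gy $ e * (y $ e - y' $ e) = 0" for e
    using nonneg sum_nonneg_eq_0_iff[of UNIV "\<lambda>e. gy $ e * (y $ e - y' $ e)"] by simp
  have one: "y' $ e = 1" if "e \<in> ?K" "y $ e = 1" for e
    using zero[of e] gy_nth(1)[OF that] \<beta> that by auto
  have "(\<Sum>e\<in>?K. y' $ e - y $ e) \<le> 0"
    using assms(1) sum_y by (simp add: sum_subtractf relaxed_edge_additions_def)
  moreover have diff: "0 \<le> y' $ e - y $ e" if "e \<in> ?K" for e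
    using y_binary[OF that] one[OF that] bounds[of e] by auto
  ultimately have "(\<Sum>e\<in>?K. y' $ e - y $ e) = 0"
    by (intro antisym sum_nonneg)
  then have "y' $ e - y $ e = 0" if "e \<in> ?K" for e
    using that diff sum_nonneg_eq_0_iff[of ?K "\<lambda>e. y' $ e - y $ e"] by simp
  then have "y' $ e = y $ e" for e
    using outside by (cases "e \<in> ?K") simp_all
  then show ?thesis
    by (simp add: vec_eq_iff)
qed

text \<open>The two block terms are nonpositive and sum to zero, so each vanishes.\<close>

lemma critical_face_subset:
  assumes "v \<in> critical_face (h_obj E \<alpha> \<beta>) (feasible_set E s) (b, y)"
  shows "fst v \<in> unit_simplex" "support (fst v) \<subseteq> C" "snd v = y"
proof -
  obtain x y' where v: "v = (x, y')"
    by (cases v)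
  have xy: "x \<in> unit_simplex" "y' \<in> Y" "gx \<bullet> (x - b) + gy \<bullet> (y' - y) = 0"
    using assms by (auto simp: v critical_face_def feasible_set_def grad_h_obj)
  with gx_nonpos[OF xy(1)] gy_nonpos[OF xy(2)] have "gx \<bullet> (x - b) = 0" "gy \<bullet> (y' - y) = 0"
    by linarith+
  with xy show "fst v \<in> unit_simplex" "support (fst v) \<subseteq> C" "snd v = y"
    using support_subset eq_y by (auto simp: v)
qed

section \<open>The objective on the critical face\<close>

text \<open>For \<open>x\<close> of total weight one on the clique \<open>C\<close>, the quadratic
  form is the squared total weight minus \<open>x \<bullet> x\<close>. The second claim prepares the
  distance computation in \<open>growth\<close>.\<close>

lemma h_obj_clique:
  assumes "x \<in> unit_simplex" "support x \<subseteq> C"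
  shows "h_obj E \<alpha> \<beta> (x, y) = 1 - (1 - \<alpha> / 2) * (x \<bullet> x) + \<beta> / 2 * (y \<bullet> y)"
    and "x \<bullet> b = 1 / N"
proof -
  have out: "x $ i = 0" if "i \<notin> C" for i
    using assms(2) that by (auto simp: support_def)
  have restrict: "(\<Sum>i\<in>UNIV. f i * x $ i) = (\<Sum>i\<in>C. f i * x $ i)" for f
    using out by (intro sum.mono_neutral_right) auto
  have one: "(\<Sum>i\<in>C. x $ i) = 1"
    using restrict[of "\<lambda>_. 1"] assms(1) by (simp add: unit_simplex_def)
  then show "x \<bullet> b = 1 / N"
    by (simp add: inner_barycenter)
  have "x \<bullet> (M *v x) = (\<Sum>i\<in>C. (M *v x) $ i * x $ i)"
    unfolding inner_vec_def restrict[symmetric] by (simp add: mult.commute)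
  also have "\<dots> = (\<Sum>i\<in>C. (1 - x $ i) * x $ i)"
    unfolding matrix_vector_mult_def
    by (intro sum.cong) (simp_all add: restrict clique_row_sum one)
  also have "\<dots> = 1 - x \<bullet> x"
    unfolding inner_vec_def by (simp add: left_diff_distrib sum_subtractf one restrict)
  finally show "h_obj E \<alpha> \<beta> (x, y) = 1 - (1 - \<alpha> / 2) * (x \<bullet> x) + \<beta> / 2 * (y \<bullet> y)"
    by (simp add: h_obj_graph_matrix algebra_simps)
qed

text \<open>Both \<open>x \<bullet> b\<close> and \<open>b \<bullet> b\<close> equal
  \<open>1 / N\<close>, so the squared distance is
  \<open>x \<bullet> x - b \<bullet> b\<close>.\<close>

lemma growth:
  assumes "v \<in> critical_face (h_obj E \<alpha> \<beta>) (feasible_set E s) (b, y)"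
  shows "h_obj E \<alpha> \<beta> v = h_obj E \<alpha> \<beta> (b, y) - (1 - \<alpha> / 2) * (dist v (b, y))\<^sup>2"
proof -
  obtain x where v: "v = (x, y)" and x: "x \<in> unit_simplex" "support x \<subseteq> C"
    using critical_face_subset[OF assms] by (cases v) auto
  have bC: "support b \<subseteq> C"
    by (auto simp: support_def barycenter_nth)
  have "(dist v (b, y))\<^sup>2 = (x - b) \<bullet> (x - b)"
    by (simp add: v dist_Pair_Pair dist_norm power2_norm_eq_inner)
  also have "\<dots> = x \<bullet> x - b \<bullet> b"
    using h_obj_clique(2)[OF x] h_obj_clique(2)[OF feasible(1) bC]
    by (simp add: inner_diff_left inner_diff_right inner_commute)
  finally have dist: "(dist v (b, y))\<^sup>2 = x \<bullet> x - b \<bullet> b" .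
  show ?thesis
    unfolding dist unfolding v h_obj_clique(1)[OF x] h_obj_clique(1)[OF feasible(1) bC]
    by (simp add: algebra_simps)
qed

end

section \<open>Convergence for the defective clique problem\<close>

theorem corollary4p2:
  fixes E :: "'n::finite set set"
    and s :: nat
    and \<alpha> \<beta> c \<rho> :: real
    and z d :: "nat \<Rightarrow> (real^'n) \<times> (real^('n set))"
    and a :: "nat \<Rightarrow> real"
    and p :: "(real^'n) \<times> (real^('n set))"
    and C :: "'n set"
    and y\<^sub>p :: "real^('n set)"
  assumes "simple_graph E"
    and "s \<le> card (complement_edges E)"
    and "0 < \<alpha>" and "\<alpha> < 2" and "0 < \<beta>"
    and "FDFW (h_obj E \<alpha> \<beta>) (feasible_set E s) z d a"
    and "\<exists>r. strict_mono r \<and> (z \<circ> r) \<longlonglongrightarrow> p"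
    and "p \<in> strict_local_maximizers (h_obj E \<alpha> \<beta>) (feasible_set E s)"
    and "C \<noteq> {}" and "p = (barycenter C, y\<^sub>p)"
    and "0 < c" and "0 < \<rho>"
    and "\<And>k. \<not> stationary (h_obj E \<alpha> \<beta>) (feasible_set E s) (z k) \<Longrightarrow>
            a k \<ge> step_bound c (h_obj E \<alpha> \<beta>) (feasible_set E s) (z k) (d k)"
    and "\<And>k. \<not> stationary (h_obj E \<alpha> \<beta>) (feasible_set E s) (z k) \<Longrightarrow>
            h_obj E \<alpha> \<beta> (z k + a k *\<^sub>R d k) - h_obj E \<alpha> \<beta> (z k) \<ge>
              \<rho> * step_bound c (h_obj E \<alpha> \<beta>) (feasible_set E s) (z k) (d k)
                * (grad (h_obj E \<alpha> \<beta>) (z k) \<bullet> d k)"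
  shows "z \<longlonglongrightarrow> p \<and>
         (\<forall>\<^sub>F k in sequentially. support (fst (z k)) \<subseteq> C \<and> snd (z k) = y\<^sub>p)"
proof -
  interpret barycentric_maximizer E s \<alpha> \<beta> C y\<^sub>p
    using assms by unfold_locales auto
  obtain r where r: "strict_mono r" "(z \<circ> r) \<longlonglongrightarrow> p"
    using assms(7) by blast
  have p: "p \<in> feasible_set E s"
    using assms(8) by (simp add: strict_local_maximizers_def)
  \<comment> \<open>This is the growth constant \<kappa> of the general convergence theorem.\<close>
  have "0 < 1 - \<alpha> / 2"
    using assms(4) by simp
  then have "z \<longlonglongrightarrow> p"
    "\<forall>\<^sub>F k in sequentially. z k \<in> critical_face (h_obj E \<alpha> \<beta>) (feasible_set E s) p"
    using FDFW_converges_in_critical_face[OF polytope_feasible_set isCont_grad_h_obj p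
      stationary[folded assms(10)] assms(6) r assms(11) less_imp_le[OF assms(12)] assms(13,14)
      _ growth[folded assms(10)]]
    by blast+
  moreover from this(2)
  have "\<forall>\<^sub>F k in sequentially. support (fst (z k)) \<subseteq> C \<and> snd (z k) = y\<^sub>p"
    by eventually_elim (use critical_face_subset assms(10) in auto)
  ultimately show ?thesis
    by blast
qed

end
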